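(* Let $\mathscr{A}$ be a $C^*$-algebra and let $\mathscr{E}$ and $\mathscr{F}$ be two full Hilbert $\mathscr{A}$-modules. Suppose that $T, S : \mathscr{E} \to \mathscr{F}$ are two nonzero bounded $\mathscr{A}$-linear operators such that for all $x, y \in \mathscr{E}$, $\langle x, y\rangle = 0$ implies $\langle T(x), S(y)\rangle = 0$. Then there exists an element $\gamma$ of the center $Z(M(\mathscr{A}))$ of the multiplier algebra $M(\mathscr{A})$ of $\mathscr{A}$ such that $$\langle T(x), S(y)\rangle = \gamma \langle x, y\rangle \qquad \text{for all } x, y\in \mathscr{E}.$$ In the case $\gamma = 0$, the ranges of $T$ and $S$ are orthogonal to each other, i.e. $\langle T(x), S(y)\rangle = 0$ for all $x,y\in\mathscr{E}$.
   Context: An inner product $\mathscr{A}$-module over a $C^*$-algebra $\mathscr{A}$ is a (complex vector space and) left $\mathscr{A}$-module $\mathscr{E}$ with an $\mathscr{A}$-valued inner product $\langle\cdot,\cdot\rangle$ which is linear and $\mathscr{A}$-linear in the first variable, satisfies $\langle x,y\rangle^*=\langle y,x\rangle$, and $\langle x,x\rangle\ge 0$ with equality if and only if $x=0$. It is a Hilbert $\mathscr{A}$-module if it is complete in the norm $\|x\|=\|\langle x,x\rangle\|^{1/2}$. It is full if the closed linear span $\langle\mathscr{E},\mathscr{E}\rangle$ of $\{\langle x,y\rangle : x,y\in\mathscr{E}\}$ equals $\mathscr{A}$. An operator $T$ is $\mathscr{A}$-linear if it is linear and $T(ax)=aT(x)$ for all $a\in\mathscr{A}$, $x\in\mathscr{E}$.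 The algebra $\mathscr{A}$ is regarded as a closed ideal of $M(\mathscr{A})$, so $\gamma\langle x,y\rangle\in\mathscr{A}$ is the product in $M(\mathscr{A})$. *)

theory Defs
  imports "HOL-Analysis.Analysis"
begin

section \<open>Complex normed spaces and C*-algebras\<close>

class complex_normed_vector = real_normed_vector +
  fixes scaleC :: "complex \<Rightarrow> 'a \<Rightarrow> 'a"  (infixr \<open>*\<^sub>C\<close> 75)
  assumes scaleC_add_right: "c *\<^sub>C (x + y) = c *\<^sub>C x + c *\<^sub>C y"
    and scaleC_add_left: "(c + d) *\<^sub>C x = c *\<^sub>C x + d *\<^sub>C x"
    and scaleC_scaleC: "c *\<^sub>C (d *\<^sub>C x) = (c * d) *\<^sub>C x"
    and scaleC_of_real: "complex_of_real r *\<^sub>C x = r *\<^sub>R x"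
    and norm_scaleC: "norm (c *\<^sub>C x) = cmod c * norm x"

interpretation complex_vector:
  vector_space "scaleC :: complex \<Rightarrow> 'a \<Rightarrow> 'a::complex_normed_vector"
proof
  fix x :: 'a
  show "1 *\<^sub>C x = x"
    using scaleC_of_real[of 1 x] by simp
qed (simp_all add: scaleC_add_right scaleC_add_left scaleC_scaleC)

text \<open>Not necessarily unital; the algebra \<open>{0}\<close> is included.\<close>

class cstar_algebra = complex_normed_vector + real_normed_algebra + banach +
  fixes star :: "'a \<Rightarrow> 'a"
  assumes mult_scaleC_left: "(c *\<^sub>C x) * y = c *\<^sub>C (x * y)"
    and mult_scaleC_right: "x * (c *\<^sub>C y) = c *\<^sub>C (x * y)"
    and star_add: "star (x + y) = star x + star y"
    and star_scaleC: "star (c *\<^sub>C x) = cnj c *\<^sub>C star x"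
    and star_mult: "star (x * y) = star y * star x"
    and star_star: "star (star x) = x"
    and norm_star_mult: "norm (star x * x) = (norm x)\<^sup>2"

definition positive :: "'a::cstar_algebra \<Rightarrow> bool"
  where "positive a \<longleftrightarrow> (\<exists>b. a = star b * b)"

definition bounded_clinear ::
    "('a::complex_normed_vector \<Rightarrow> 'b::complex_normed_vector) \<Rightarrow> bool"
  where "bounded_clinear f \<longleftrightarrow> bounded_linear f \<and> (\<forall>c x. f (c *\<^sub>C x) = c *\<^sub>C f x)"

section \<open>Hilbert C*-modules\<close>

text \<open>
  The module is a whole type \<open>'e\<close>. The space \<open>'e\<close> carries a norm by its type class, and
  \<open>norm_eq\<close> says that this norm is the one induced by the \<open>'a\<close>-valued inner product, so that
  boundedness and completeness (class \<open>banach\<close>) refer to the induced norm.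
\<close>

locale inner_product_module =
  fixes act :: "'a::cstar_algebra \<Rightarrow> 'e::complex_normed_vector \<Rightarrow> 'e"
    and ip :: "'e \<Rightarrow> 'e \<Rightarrow> 'a"
  assumes act_add_right: "act a (x + y) = act a x + act a y"
    and act_add_left: "act (a + b) x = act a x + act b x"
    and act_mult: "act (a * b) x = act a (act b x)"
    and act_scaleC_left: "act (c *\<^sub>C a) x = c *\<^sub>C act a x"
    and act_scaleC_right: "act a (c *\<^sub>C x) = c *\<^sub>C act a x"
    and ip_add_left: "ip (x + y) z = ip x z + ip y z"
    and ip_scaleC_left: "ip (c *\<^sub>C x) y = c *\<^sub>C ip x y"
    and ip_act_left: "ip (act a x) y = a * ip x y"
    and star_ip: "star (ip x y) = ip y x"
    and ip_positive: "positive (ip x x)"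
    and ip_eq_0_iff: "ip x x = 0 \<longleftrightarrow> x = 0"
    and norm_eq: "norm x = sqrt (norm (ip x x))"

locale hilbert_module = inner_product_module act ip
  for act :: "'a::cstar_algebra \<Rightarrow> 'e::{complex_normed_vector,banach} \<Rightarrow> 'e"
    and ip :: "'e \<Rightarrow> 'e \<Rightarrow> 'a"

locale full_hilbert_module = hilbert_module act ip
  for act :: "'a::cstar_algebra \<Rightarrow> 'e::{complex_normed_vector,banach} \<Rightarrow> 'e"
    and ip :: "'e \<Rightarrow> 'e \<Rightarrow> 'a" +
  assumes full: "closure (complex_vector.span {ip x y | x y. True}) = UNIV"

definition bounded_module_map ::
    "('a \<Rightarrow> 'e \<Rightarrow> 'e) \<Rightarrow> ('a \<Rightarrow> 'f \<Rightarrow> 'f) \<Rightarrow>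
     ('e::complex_normed_vector \<Rightarrow> 'f::complex_normed_vector) \<Rightarrow> bool"
  where "bounded_module_map act act' T \<longleftrightarrow>
    bounded_clinear T \<and> (\<forall>a x. T (act a x) = act' a (T x))"

section \<open>The multiplier algebra\<close>

text \<open>
  \<open>M(A)\<close> is realised as the algebra of double centralizers \<open>(L, R)\<close> of \<open>A\<close>, where \<open>L\<close> and \<open>R\<close>
  stand for left and right multiplication by the multiplier.
\<close>

definition double_centralizer ::
    "('a::cstar_algebra \<Rightarrow> 'a) \<times> ('a \<Rightarrow> 'a) \<Rightarrow> bool"
  where "double_centralizer = (\<lambda>(L, R). bounded_clinear L \<and> bounded_clinear R \<and>
    (\<forall>a b. L (a * b) = L a * b) \<and> (\<forall>a b. R (a * b) = a * R b) \<and> (\<forall>a b. R a * b = a * L b))"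

lemma bounded_clinear_intros:
  "bounded_clinear (\<lambda>x. 0)"
  "bounded_clinear (\<lambda>x. x)"
  "bounded_clinear f \<Longrightarrow> bounded_clinear g \<Longrightarrow> bounded_clinear (\<lambda>x. f x + g x)"
  "bounded_clinear f \<Longrightarrow> bounded_clinear (\<lambda>x. - f x)"
  "bounded_clinear f \<Longrightarrow> bounded_clinear g \<Longrightarrow> bounded_clinear (\<lambda>x. f x - g x)"
  by (auto simp: bounded_clinear_def complex_vector.scale_right_distrib
      complex_vector.scale_right_diff_distrib
      intro: bounded_linear_add bounded_linear_minus bounded_linear_sub)

lemma bounded_clinear_comp:
  "bounded_clinear f \<Longrightarrow> bounded_clinear g \<Longrightarrow> bounded_clinear (\<lambda>x. f (g x))"
  by (auto simp: bounded_clinear_def intro: bounded_linear_compose)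

lemma bounded_clinear_mult:
  "bounded_clinear (\<lambda>b::'a::cstar_algebra. a * b)"
  "bounded_clinear (\<lambda>b::'a::cstar_algebra. b * a)"
  by (auto simp: bounded_clinear_def mult_scaleC_left mult_scaleC_right
      intro: bounded_linear_mult_right bounded_linear_mult_left)

typedef (overloaded) 'a multiplier =
  "{p :: ('a::cstar_algebra \<Rightarrow> 'a) \<times> ('a \<Rightarrow> 'a). double_centralizer p}"
  by (rule exI[of _ "(\<lambda>x. 0, \<lambda>x. 0)"])
    (auto simp: double_centralizer_def bounded_clinear_intros)

setup_lifting type_definition_multiplier

instantiation multiplier :: (cstar_algebra) ring
begin

lift_definition zero_multiplier :: "'a multiplier" is "(\<lambda>x. 0, \<lambda>x. 0)"
  by (auto simp: double_centralizer_def bounded_clinear_intros)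

lift_definition plus_multiplier :: "'a multiplier \<Rightarrow> 'a multiplier \<Rightarrow> 'a multiplier"
  is "\<lambda>(L, R) (L', R'). (\<lambda>x. L x + L' x, \<lambda>x. R x + R' x)"
  by (auto simp: double_centralizer_def bounded_clinear_intros algebra_simps)

lift_definition uminus_multiplier :: "'a multiplier \<Rightarrow> 'a multiplier"
  is "\<lambda>(L, R). (\<lambda>x. - L x, \<lambda>x. - R x)"
  by (auto simp: double_centralizer_def bounded_clinear_intros)

lift_definition minus_multiplier :: "'a multiplier \<Rightarrow> 'a multiplier \<Rightarrow> 'a multiplier"
  is "\<lambda>(L, R) (L', R'). (\<lambda>x. L x - L' x, \<lambda>x. R x - R' x)"
  by (auto simp: double_centralizer_def bounded_clinear_intros algebra_simps)

lift_definition times_multiplier :: "'a multiplier \<Rightarrow> 'a multiplier \<Rightarrow> 'a multiplier"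
  is "\<lambda>(L, R) (L', R'). (\<lambda>x. L (L' x), \<lambda>x. R' (R x))"
  by (auto simp: double_centralizer_def bounded_clinear_comp)

instance
proof
  fix x y z :: "'a multiplier"
  show "x + y + z = x + (y + z)" "x + y = y + x" "0 + x = x" "- x + x = 0" "x - y = x + - y"
    "x * y * z = x * (y * z)"
    by (transfer; auto simp: algebra_simps)+
  show "(x + y) * z = x * z + y * z" "x * (y + z) = x * y + x * z"
    by (transfer; auto simp: double_centralizer_def bounded_clinear_def linear_simps)+
qed

end

instantiation multiplier :: (cstar_algebra) monoid_mult
begin

lift_definition one_multiplier :: "'a multiplier" is "(\<lambda>x. x, \<lambda>x. x)"
  by (auto simp: double_centralizer_def bounded_clinear_intros)

instance
  by standard (transfer; auto)+

end

text \<open>The canonical copy of \<open>A\<close> in \<open>M(A)\<close>.\<close>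

lift_definition to_multiplier :: "'a::cstar_algebra \<Rightarrow> 'a multiplier"
  is "\<lambda>a. (\<lambda>b. a * b, \<lambda>b. b * a)"
  by (auto simp: double_centralizer_def bounded_clinear_mult mult.assoc)

lemma to_multiplier_add: "to_multiplier (a + b) = to_multiplier a + to_multiplier b"
  by transfer (auto simp: algebra_simps)

lemma to_multiplier_mult: "to_multiplier (a * b) = to_multiplier a * to_multiplier b"
  by transfer (auto simp: mult.assoc)

lemma inj_to_multiplier: "inj (to_multiplier :: 'a::cstar_algebra \<Rightarrow> 'a multiplier)"
proof (rule injI)
  fix a b :: 'a
  assume "to_multiplier a = to_multiplier b"
  then have "x * a = x * b" for x
    by transfer (auto dest: fun_cong)
  then have "star (a - b) * (a - b) = 0"
    by (simp add: right_diff_distrib)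
  then show "a = b"
    using norm_star_mult[of "a - b"] by simp
qed

lemma to_multiplier_ideal:
  "m * to_multiplier a \<in> range to_multiplier" "to_multiplier a * m \<in> range to_multiplier"
proof -
  have "m * to_multiplier a = to_multiplier (fst (Rep_multiplier m) a)"
    by transfer (auto simp: double_centralizer_def)
  then show "m * to_multiplier a \<in> range to_multiplier" by simp
  have "to_multiplier a * m = to_multiplier (snd (Rep_multiplier m) a)"
    by transfer (auto simp: double_centralizer_def)
  then show "to_multiplier a * m \<in> range to_multiplier" by simp
qed

definition center :: "'a::semigroup_mult set"
  where "center = {z. \<forall>w. z * w = w * z}"

end

theory Submission
  imports Defs
begin

text \<open>
  Put \<open>B x y = \<langle>T x, S y\<rangle>\<close>. This is a bounded sesquilinear form with
  values in the algebra that vanishes on orthogonal pairs and satisfies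
  \<open>B (a x) (b y) = a (B x y) b\<^sup>*\<close>. The proof has two halves.

  The analytic half shows that \<open>B (K x) y = B x (K' y)\<close> whenever \<open>K'\<close> is
  the adjoint of \<open>K\<close> (\<open>form_adjoint\<close>). If \<open>f\<close> and
  \<open>g\<close> are functions on the circle with \<open>f g = 0\<close> and \<open>U\<close> is a
  unitary operator on the module, then \<open>f(U) x\<close> and \<open>g(U) y\<close> are
  orthogonal, so \<open>B\<close> vanishes on them. It is enough to take for \<open>f\<close> and
  \<open>g\<close> the positive and the negative part of a rotated sine. Their Fourier series
  converge absolutely, so \<open>f(U)\<close> is a norm convergent series in the powers of
  \<open>U\<close>, and \<open>f g = 0\<close> is the convolution identity
  \<open>abs_sin_convolution\<close>. Comparing Fourier coefficients with respect to the angle of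
  rotation turns the vanishing of \<open>B\<close> into the vanishing of the third difference of
  \<open>n \<mapsto> B (U\<^sup>n x) (U\<^sup>n y)\<close>. This sequence is bounded, hence
  constant, that is, \<open>B (U x) (U y) = B x y\<close> (\<open>form_unitary_invariant\<close>).
  Applied to Cayley transforms of small skew operators, this invariance linearises to the claim
  about adjoints.

  The algebraic half uses the adjoint relation for rank one operators only. There it reads
  \<open>\<langle>x, y\<rangle> B z w = B x y \<langle>z, w\<rangle>\<close>
  (\<open>form_ip_exchange\<close>), so \<open>\<langle>x, y\<rangle> \<mapsto> B x y\<close> looks
  like multiplication by a central element. That it extends to a bounded map on the whole algebra
  follows from fullness: if \<open>b \<langle>z, w\<rangle> = a (B z w)\<close> for all
  \<open>z\<close> and \<open>w\<close>, then \<open>\<langle>b x, y\<rangle> = B (a x) y\<close>,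
  so \<open>b\<close> acts on the module with norm at most a constant times that of
  \<open>a\<close>, and a spectral radius argument bounds the norm of \<open>b\<close> by the norm
  of its action (\<open>norm_le_of_act\<close>). The extended map commutes with left and right
  multiplication and is therefore a central multiplier.
\<close>

section \<open>Fourier coefficients of the absolute value of the sine\<close>

text \<open>
  Up to the factor \<open>2 / (pi * i)\<close>, \<open>odd_recip j\<close> is the Fourier
  coefficient of index \<open>2 * j + 1\<close> of the sign of the sine. These coefficients are not
  absolutely summable, but their correlations are.
\<close>

definition odd_recip :: "int \<Rightarrow> real"
  where "odd_recip j = 1 / (2 * of_int j + 1)"

text \<open>
  Up to the factor \<open>2 / pi\<close>, the Fourier coefficient of index \<open>2 * j\<close> of
  \<open>\<bar>sin t\<bar>\<close>.
\<close>

definition abs_sin_coeff :: "int \<Rightarrow> real"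
  where "abs_sin_coeff j = 1 / (1 - 4 * (of_int j)\<^sup>2)"

lemma odd_nonzero: "2 * real_of_int j + 1 \<noteq> 0" "2 * real_of_int j - 1 \<noteq> 0"
proof -
  have "real_of_int (2 * j + 1) \<noteq> 0" "real_of_int (2 * j - 1) \<noteq> 0"
    by (simp_all only: of_int_eq_0_iff) presburger+
  then show "2 * real_of_int j + 1 \<noteq> 0" "2 * real_of_int j - 1 \<noteq> 0" by simp_all
qed

lemma has_sum_int_shift:
  "((\<lambda>j. f (j + n)) has_sum S) UNIV \<longleftrightarrow> (f has_sum S) (UNIV :: int set)"
proof (rule has_sum_reindex_bij_betw)
  show "bij_betw (\<lambda>j. j + n) UNIV (UNIV :: int set)"
    by (rule bij_betw_byWitness[of _ "\<lambda>j. j - n"]) auto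
qed

lemma has_sum_int_reflect:
  "((\<lambda>j. f (- j)) has_sum S) UNIV \<longleftrightarrow> (f has_sum S) (UNIV :: int set)"
proof (rule has_sum_reindex_bij_betw)
  show "bij_betw (\<lambda>j. - j) UNIV (UNIV :: int set)"
    by (rule bij_betw_byWitness[of _ "\<lambda>j. - j"]) auto
qed

lemma has_sum_diff:
  fixes f g :: "'b \<Rightarrow> 'a::real_normed_vector"
  assumes "(f has_sum a) A" "(g has_sum b) A"
  shows "((\<lambda>x. f x - g x) has_sum (a - b)) A"
  using has_sum_add[OF assms(1) has_sum_bounded_linear[OF bounded_linear_minus[OF bounded_linear_ident] assms(2)]]
  by simp

lemma has_sum_int_split:
  fixes f :: "int \<Rightarrow> real"
  assumes "((\<lambda>n. f (int n + 1)) has_sum a) UNIV" "((\<lambda>n. f (- int n - 1)) has_sum b) UNIV"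
  shows "(f has_sum (f 0 + a + b)) UNIV"
proof -
  have "(f has_sum a) {1..}"
    using assms(1)
    by (subst has_sum_reindex_bij_betw[symmetric, where g = "\<lambda>n. int n + 1" and A = UNIV])
      (auto intro!: bij_betw_byWitness[of _ "\<lambda>j. nat (j - 1)"])
  moreover have "(f has_sum b) {..-1}"
    using assms(2)
    by (subst has_sum_reindex_bij_betw[symmetric, where g = "\<lambda>n. - int n - 1" and A = UNIV])
      (auto intro!: bij_betw_byWitness[of _ "\<lambda>j. nat (- j - 1)"])
  moreover have "(f has_sum f 0) {0}"
    by (rule has_sum_finiteI) auto
  ultimately have "(f has_sum (f 0 + a + b)) ({0} \<union> {1..} \<union> {..-1})"
    by (intro has_sum_Un_disjoint) auto
  moreover have "{0} \<union> {1..} \<union> {..-1} = (UNIV :: int set)" by auto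
  ultimately show ?thesis by simp
qed

lemma summable_odd_recip_square: "(\<lambda>j. (odd_recip j)\<^sup>2) summable_on UNIV"
proof -
  have "summable (\<lambda>n. inverse (real n ^ 2))"
    by (rule inverse_power_summable) simp
  then have "summable (\<lambda>n. inverse (real (Suc n) ^ 2))"
    by (subst summable_Suc_iff)
  then have *: "(\<lambda>n. inverse (real (Suc n) ^ 2)) summable_on UNIV"
    by (rule summable_nonneg_imp_summable_on) auto
  have le: "(odd_recip (int n + 1))\<^sup>2 \<le> inverse (real (Suc n) ^ 2)"
    "(odd_recip (- int n - 1))\<^sup>2 \<le> inverse (real (Suc n) ^ 2)" for n
  proof -
    have "(1 + real n)\<^sup>2 \<le> (2 * (real n + 1) + 1)\<^sup>2" "(1 + real n)\<^sup>2 \<le> (2 * real n + 1)\<^sup>2"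
      by (rule power_mono; simp)+
    moreover have "(2 * (- real n - 1) + 1)\<^sup>2 = (2 * real n + 1)\<^sup>2"
      by (simp add: power2_eq_square algebra_simps)
    ultimately show "(odd_recip (int n + 1))\<^sup>2 \<le> inverse (real (Suc n) ^ 2)"
      "(odd_recip (- int n - 1))\<^sup>2 \<le> inverse (real (Suc n) ^ 2)"
      unfolding odd_recip_def
      by (auto simp: power_divide inverse_eq_divide intro!: divide_left_mono mult_pos_pos)
  qed
  have "(\<lambda>n. (odd_recip (int n + 1))\<^sup>2) summable_on UNIV"
    "(\<lambda>n. (odd_recip (- int n - 1))\<^sup>2) summable_on UNIV"
    by (rule summable_on_comparison_test[OF *]; use le in simp)+
  then obtain a b where "((\<lambda>n. (odd_recip (int n + 1))\<^sup>2) has_sum a) UNIV"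
    "((\<lambda>n. (odd_recip (- int n - 1))\<^sup>2) has_sum b) UNIV"
    unfolding summable_on_def by blast
  from has_sum_int_split[OF this] show ?thesis
    unfolding summable_on_def by (rule exI)
qed

text \<open>
  The value is \<open>pi\<^sup>2 / 4\<close>, but only its positivity matters: it is the scale on
  which the coefficients above represent \<open>\<bar>sin t\<bar>\<close>.
\<close>

definition odd_square_sum :: real
  where "odd_square_sum = (\<Sum>\<^sub>\<infinity>j. (odd_recip j)\<^sup>2)"

lemma odd_square_sum_pos: "odd_square_sum > 0"
proof -
  have "(\<Sum>j\<in>{0}. (odd_recip j)\<^sup>2) \<le> odd_square_sum"
    unfolding odd_square_sum_def
    by (rule finite_sum_le_infsum[OF summable_odd_recip_square]) auto
  then show ?thesis by (simp add: odd_recip_def)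
qed

lemma abs_sin_coeff_eq:
  "abs_sin_coeff j = (odd_recip j - odd_recip (j - 1)) / 2"
  "abs_sin_coeff j = - odd_recip j * odd_recip (j - 1)"
proof -
  have "1 - 4 * (real_of_int j)\<^sup>2 = - ((2 * j + 1) * (2 * j - 1))"
    by (simp add: power2_eq_square algebra_simps)
  then show "abs_sin_coeff j = (odd_recip j - odd_recip (j - 1)) / 2"
    "abs_sin_coeff j = - odd_recip j * odd_recip (j - 1)"
    using odd_nonzero[of j]
    by (simp_all add: abs_sin_coeff_def odd_recip_def divide_simps algebra_simps)
qed

lemma abs_sin_coeff_minus: "abs_sin_coeff (- j) = abs_sin_coeff j"
  by (simp add: abs_sin_coeff_def)

text \<open>
  For \<open>n = 1\<close> the positive and the negative half of the series telescope to
  \<open>1\<close> each and cancel against the value \<open>-2\<close> at \<open>j = 0\<close>. A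
  difference of step \<open>n\<close> is a sum of translates of the difference of step
  \<open>1\<close>, so its sum vanishes as well.
\<close>

lemma odd_recip_diff_has_sum:
  "((\<lambda>j. odd_recip (j - n) - odd_recip j) has_sum 0) UNIV"
proof -
  have one: "((\<lambda>j. odd_recip (j - 1) - odd_recip j) has_sum 0) UNIV"
  proof -
    have "(\<lambda>n. odd_recip (int n)) \<longlonglongrightarrow> 0"
      using LIMSEQ_subseq_LIMSEQ[OF lim_1_over_n[where ?'a = real], of "\<lambda>n. 2 * n + 1"]
      by (simp add: odd_recip_def o_def strict_mono_def add.commute)
    then have "(\<lambda>n. odd_recip (int n) - odd_recip (int (Suc n))) sums (odd_recip (int 0) - 0)"
      by (rule telescope_sums')
    moreover have "odd_recip (int n) - odd_recip (int (Suc n)) \<ge> 0" for n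
      by (simp add: odd_recip_def divide_simps)
    ultimately have "((\<lambda>n. odd_recip (int n) - odd_recip (int (Suc n))) has_sum 1) UNIV"
      by (intro sums_nonneg_imp_has_sum) (auto simp: odd_recip_def)
    then have "((\<lambda>n. odd_recip (int n + 1 - 1) - odd_recip (int n + 1)) has_sum 1) UNIV"
      by (simp add: add.commute)
    moreover have "odd_recip (- int n - 1 - 1) - odd_recip (- int n - 1) =
      odd_recip (int n + 1 - 1) - odd_recip (int n + 1)" for n
      using odd_nonzero[of "- int n - 2"] odd_nonzero[of "- int n - 1"]
      by (simp add: odd_recip_def divide_simps) (simp add: algebra_simps)
    ultimately show ?thesis
      using has_sum_int_split[of "\<lambda>j. odd_recip (j - 1) - odd_recip j" 1 1]
      by (simp add: odd_recip_def)
  qed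
  have step: "((\<lambda>j. odd_recip (j - (m + 1)) - odd_recip j) has_sum s) UNIV \<longleftrightarrow>
      ((\<lambda>j. odd_recip (j - m) - odd_recip j) has_sum s) UNIV" for m s
  proof -
    have "((\<lambda>j. odd_recip (j - m - 1) - odd_recip (j - m)) has_sum 0) UNIV"
      using one has_sum_int_shift[of "\<lambda>j. odd_recip (j - 1) - odd_recip j" "- m" 0] by simp
    note shift = this
    show ?thesis
      using has_sum_add[OF shift, of "\<lambda>j. odd_recip (j - m) - odd_recip j" s]
        has_sum_diff[OF _ shift, of "\<lambda>j. odd_recip (j - (m + 1)) - odd_recip j" s]
      by (auto simp: algebra_simps)
  qed
  show ?thesis
  proof (induction n rule: int_induct[where k = 0])
    case (step2 i)
    then show ?case using step[of "i - 1" 0] by simp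
  qed (use step in auto)
qed

text \<open>
  The sign of the sine has square \<open>1\<close>, so its Fourier coefficients are orthogonal to
  their translates. Directly: by partial fractions the product is a multiple of a difference of step
  \<open>n\<close>, whose sum vanishes.
\<close>

lemma odd_recip_correlation:
  "((\<lambda>j. odd_recip j * odd_recip (j - n)) has_sum (if n = 0 then odd_square_sum else 0)) UNIV"
proof (cases "n = 0")
  case True
  then show ?thesis
    using has_sum_infsum[OF summable_odd_recip_square]
    by (simp add: odd_square_sum_def power2_eq_square)
next
  case False
  have "odd_recip j * odd_recip (j - n) = (odd_recip (j - n) - odd_recip j) * (1 / (2 * n))" for j
    using odd_nonzero(1)[of j] odd_nonzero(1)[of "j - n"] False
    by (simp add: odd_recip_def divide_simps)
  moreover have "((\<lambda>j. (odd_recip (j - n) - odd_recip j) * (1 / (2 * n))) has_sum 0 * (1 / (2 * n))) UNIV"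
    by (rule has_sum_cmult_left[OF odd_recip_diff_has_sum])
  ultimately show ?thesis using False by simp
qed

text \<open>
  The Fourier coefficients of \<open>odd_square_sum * (sin t)\<^sup>2\<close>, again at the even
  index \<open>2 * n\<close>.
\<close>

definition sin_square_coeff :: "int \<Rightarrow> real"
  where "sin_square_coeff n =
    (if n = 0 then odd_square_sum / 2 else if \<bar>n\<bar> = 1 then - odd_square_sum / 4 else 0)"

text \<open>
  The identity \<open>\<bar>sin t\<bar>\<^sup>2 = (sin t)\<^sup>2\<close> in terms of Fourier
  coefficients. Since \<open>abs_sin_coeff\<close> is half the difference of two translates of
  \<open>odd_recip\<close>, its convolution square is a combination of three correlations of
  \<open>odd_recip\<close>.
\<close>

lemma abs_sin_convolution:
  "((\<lambda>j. abs_sin_coeff j * abs_sin_coeff (n - j)) has_sum sin_square_coeff n) UNIV"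
proof -
  define F where "F n = (if n = 0 then odd_square_sum else 0)" for n :: int
  have 1: "((\<lambda>j. odd_recip j * odd_recip (j - m)) has_sum F m) UNIV" for m
    unfolding F_def by (rule odd_recip_correlation)
  have 2: "((\<lambda>j. odd_recip (j - 1) * odd_recip (j - 1 - m)) has_sum F m) UNIV" for m
    using 1[of m] has_sum_int_shift[of "\<lambda>j. odd_recip j * odd_recip (j - m)" "- 1" "F m"] by simp
  have sum: "((\<lambda>j. (1 / 4) * ((odd_recip j * odd_recip (j - n) + odd_recip (j - 1) * odd_recip (j - 1 - n))
      - (odd_recip j * odd_recip (j - (n + 1)) + odd_recip (j - 1) * odd_recip (j - 1 - (n - 1)))))
      has_sum (1 / 4) * ((F n + F n) - (F (n + 1) + F (n - 1)))) UNIV"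
    by (intro has_sum_cmult_right has_sum_diff has_sum_add 1 2)
  have "abs_sin_coeff j * abs_sin_coeff (n - j) =
     (1 / 4) * ((odd_recip j * odd_recip (j - n) + odd_recip (j - 1) * odd_recip (j - 1 - n))
      - (odd_recip j * odd_recip (j - (n + 1)) + odd_recip (j - 1) * odd_recip (j - 1 - (n - 1))))" for j
  proof -
    have "abs_sin_coeff (n - j) = (odd_recip (j - n) - odd_recip (j - 1 - n)) / 2"
      using abs_sin_coeff_minus[of "j - n"] abs_sin_coeff_eq(1)[of "j - n"] by (simp add: algebra_simps)
    moreover have "j - (n + 1) = j - 1 - n" "j - 1 - (n - 1) = j - n" by simp_all
    ultimately show ?thesis
      by (simp only: abs_sin_coeff_eq(1)[of j]) (simp add: field_simps)
  qed
  moreover have "(1 / 4) * ((F n + F n) - (F (n + 1) + F (n - 1))) = sin_square_coeff n"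
    by (auto simp: F_def sin_square_coeff_def)
  ultimately show ?thesis using sum by (simp only:)
qed

lemma abs_sin_coeff_summable: "(\<lambda>j. \<bar>abs_sin_coeff j\<bar>) summable_on UNIV"
proof -
  have 1: "(\<lambda>j. odd_recip (j - 1) * odd_recip (j - 1)) summable_on UNIV"
    using odd_recip_correlation[of 0]
      has_sum_int_shift[of "\<lambda>j. odd_recip j * odd_recip j" "- 1" odd_square_sum]
    by (auto simp: summable_on_def)
  have 0: "(\<lambda>j. odd_recip j * odd_recip j) summable_on UNIV"
    using odd_recip_correlation[of 0] by (auto simp: summable_on_def)
  have "(\<lambda>j. norm (odd_recip j * odd_recip (j - 1))) summable_on UNIV"
    by (rule abs_summable_product) (use 0 1 in simp_all)
  then show ?thesis by (simp add: abs_sin_coeff_eq(2) abs_mult)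
qed

section \<open>Bounded sequences and Fourier series\<close>

lemma bounded_constant_difference:
  fixes f :: "int \<Rightarrow> 'a::real_normed_vector"
  assumes step: "\<And>n. f (n + 1) - f n = c" and bound: "\<And>n. norm (f n) \<le> M"
  shows "c = 0"
proof (rule ccontr)
  assume "c \<noteq> 0"
  have f: "f (int n) = f 0 + real n *\<^sub>R c" for n
  proof (induction n)
    case (Suc n)
    then show ?case using step[of "int n"] by (simp add: algebra_simps)
  qed simp
  have "real n * norm c \<le> 2 * M" for n
  proof -
    have "real n *\<^sub>R c = f (int n) - f 0" by (simp add: f)
    then have "real n * norm c = norm (f (int n) - f 0)"
      by (metis norm_scaleR abs_of_nat)
    also have "\<dots> \<le> 2 * M"
      using norm_triangle_ineq4[of "f (int n)" "f 0"] bound[of "int n"] bound[of 0] by linarith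
    finally show ?thesis .
  qed
  moreover obtain n where "real n * norm c > 2 * M"
    using reals_Archimedean3[of "norm c"] \<open>c \<noteq> 0\<close> by auto
  ultimately show False by (meson not_le)
qed

lemma int_shift_invariant_constant:
  fixes g :: "int \<Rightarrow> 'a"
  assumes "\<And>n. g (n + 1) = g n"
  shows "g n = g 0"
proof (induction n rule: int_induct[where k = 0])
  case (step2 i)
  then show ?case using assms[of "i - 1"] by simp
qed (use assms in auto)

text \<open>
  A vanishing third difference makes \<open>D\<close> a polynomial of degree at most two in
  \<open>n\<close>, and a bounded polynomial is constant: a nonzero constant difference, first of
  the differences and then of \<open>D\<close> itself, would force linear growth.
\<close>

lemma bounded_third_difference_zero:
  fixes D :: "int \<Rightarrow> 'a::real_normed_vector"
  assumes third: "\<And>n. D (n + 3) - 3 *\<^sub>R D (n + 2) + 3 *\<^sub>R D (n + 1) - D n = 0"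
    and bound: "\<And>n. norm (D n) \<le> M"
  shows "D (n + 1) = D n"
proof -
  define E where "E n = D (n + 1) - D n" for n
  have Eb: "norm (E n) \<le> 2 * M" for n
    using norm_triangle_ineq4[of "D (n + 1)" "D n"] bound[of n] bound[of "n + 1"]
    by (simp add: E_def)
  have three: "3 *\<^sub>R v = v + v + v" for v :: 'a
    using scaleR_add_left[of 2 1 v] by (simp add: scaleR_2)
  have "E (n + 1 + 1) - E (n + 1) = E (n + 1) - E n" for n
    using third[of n] by (simp add: E_def three algebra_simps)
  then have EE: "E (n + 1) - E n = E (0 + 1) - E 0" for n
    by (rule int_shift_invariant_constant)
  have "E (0 + 1) - E 0 = 0"
    by (rule bounded_constant_difference[where f = E, OF EE Eb])
  then have "E n = E 0" for n
    using EE by (intro int_shift_invariant_constant) simp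
  then have "D (n + 1) - D n = E 0" for n by (simp add: E_def)
  then have "E 0 = 0" by (rule bounded_constant_difference[where f = D, OF _ bound])
  then show ?thesis using \<open>D (n + 1) - D n = E 0\<close> by simp
qed

text \<open>
  Uniqueness of the coefficients of an absolutely convergent Fourier series. Averaging over the
  \<open>M\<close>-th roots of unity \<open>v\<close>, weighted by the inverse of
  \<open>v powi k\<close>, isolates the coefficient \<open>C k\<close> from a finite partial sum
  once \<open>M\<close> exceeds all \<open>\<bar>j - k\<bar>\<close>; the rest of the series is
  uniformly small.
\<close>

lemma fourier_coefficients_zero:
  fixes C :: "int \<Rightarrow> 'a::{complex_normed_vector, banach}"
  assumes summ: "(\<lambda>j. norm (C j)) summable_on UNIV"
    and zero: "\<And>v. cmod v = 1 \<Longrightarrow> ((\<lambda>j. (v powi j) *\<^sub>C C j) has_sum 0) UNIV"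
  shows "C k = 0"
proof -
  have "norm (C k) \<le> \<epsilon>" if "\<epsilon> > 0" for \<epsilon>
  proof -
    obtain F0 where "finite F0" and F0: "dist (\<Sum>j\<in>F0. norm (C j)) (\<Sum>\<^sub>\<infinity>j. norm (C j)) \<le> \<epsilon>"
      using infsum_finite_approximation[OF summ \<open>\<epsilon> > 0\<close>] by auto
    define F where "F = insert k F0"
    have fin: "finite F" and k: "k \<in> F" using \<open>finite F0\<close> by (auto simp: F_def)
    have split: "(\<Sum>\<^sub>\<infinity>j. norm (C j)) = (\<Sum>j\<in>F. norm (C j)) + (\<Sum>\<^sub>\<infinity>j\<in>-F. norm (C j))"
      using infsum_Un_disjoint[of "\<lambda>j. norm (C j)" F "- F"]
        summable_on_subset_banach[OF summ, of "- F"] fin by simp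
    have tail: "(\<Sum>\<^sub>\<infinity>j\<in>-F. norm (C j)) \<le> \<epsilon>"
    proof -
      have "(\<Sum>j\<in>F0. norm (C j)) \<le> (\<Sum>j\<in>F. norm (C j))"
        by (rule sum_mono2) (use fin in \<open>auto simp: F_def\<close>)
      then show ?thesis using F0 split by (auto simp: dist_real_def)
    qed
    have part: "norm (\<Sum>j\<in>F. (v powi j) *\<^sub>C C j) \<le> \<epsilon>" if v: "cmod v = 1" for v
    proof -
      have n: "norm ((v powi j) *\<^sub>C C j) = norm (C j)" for j
        by (simp add: norm_scaleC norm_power_int v)
      have s: "(\<lambda>j. norm ((v powi j) *\<^sub>C C j)) summable_on - F"
        unfolding n using summ by (rule summable_on_subset_banach) simp
      have "((\<lambda>j. (v powi j) *\<^sub>C C j) has_sum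
          ((\<Sum>j\<in>F. (v powi j) *\<^sub>C C j) + (\<Sum>\<^sub>\<infinity>j\<in>-F. (v powi j) *\<^sub>C C j))) (F \<union> - F)"
        by (rule has_sum_Un_disjoint[OF has_sum_finite[OF fin] has_sum_infsum[OF abs_summable_summable[OF s]]]) simp
      then have "((\<lambda>j. (v powi j) *\<^sub>C C j) has_sum
          ((\<Sum>j\<in>F. (v powi j) *\<^sub>C C j) + (\<Sum>\<^sub>\<infinity>j\<in>-F. (v powi j) *\<^sub>C C j))) UNIV"
        by simp
      then have "(\<Sum>j\<in>F. (v powi j) *\<^sub>C C j) + (\<Sum>\<^sub>\<infinity>j\<in>-F. (v powi j) *\<^sub>C C j) = 0"
        using zero[OF v] has_sum_unique by blast
      then have "norm (\<Sum>j\<in>F. (v powi j) *\<^sub>C C j) = norm (\<Sum>\<^sub>\<infinity>j\<in>-F. (v powi j) *\<^sub>C C j)"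
        by (metis add_eq_0_iff norm_minus_cancel)
      also have "\<dots> \<le> (\<Sum>\<^sub>\<infinity>j\<in>-F. norm ((v powi j) *\<^sub>C C j))"
        by (rule norm_infsum_bound[OF s])
      finally show ?thesis using tail by (simp add: n)
    qed
    define M where "M = Suc (\<Sum>j\<in>F. nat \<bar>j - k\<bar>)"
    define \<zeta> where "\<zeta> = cis (2 * pi / M)"
    have "M > 0" by (simp add: M_def)
    have \<zeta>1: "cmod \<zeta> = 1" "\<zeta> \<noteq> 0" by (simp_all add: \<zeta>_def)
    have mean: "(\<Sum>r<M. (\<zeta> ^ r) powi (j - k)) = (if j = k then of_nat M else 0)" if "j \<in> F" for j
    proof (cases "j = k")
      case False
      have "nat \<bar>j - k\<bar> \<le> (\<Sum>j\<in>F. nat \<bar>j - k\<bar>)"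
        using that fin by (intro member_le_sum) auto
      then have "nat \<bar>j - k\<bar> < M" unfolding M_def by linarith
      then have lt: "\<bar>j - k\<bar> < int M" by linarith
      define z where "z = \<zeta> powi (j - k)"
      have z: "z = cis (2 * pi * of_int (j - k) / M)"
        by (simp add: z_def \<zeta>_def cis_power_int mult.commute)
      have "z \<noteq> 1"
      proof
        assume "z = 1"
        then have "cos (2 * pi * of_int (j - k) / M) = 1"
          by (simp add: z complex_eq_iff)
        then obtain m :: int where "2 * pi * of_int (j - k) / M = of_int m * 2 * pi"
          by (auto simp: cos_one_2pi_int)
        then have "(2 * pi) * real_of_int (j - k) = (2 * pi) * real_of_int (m * int M)"
          using \<open>M > 0\<close> by (simp add: field_simps)
        then have "real_of_int (j - k) = real_of_int (m * int M)"
          by (subst (asm) mult_cancel_left) simp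
        then have "j - k = m * int M" by (simp only: of_int_eq_iff)
        then have "int M dvd j - k" by simp
        then show False using lt False zdvd_imp_le[of "int M" "\<bar>j - k\<bar>"] by simp
      qed
      have "z ^ M = cis (2 * pi * of_int (j - k))"
        using \<open>M > 0\<close> unfolding z Complex.DeMoivre by (intro arg_cong[of _ _ cis]) simp
      also have "\<dots> = 1" by (rule cis_multiple_2pi) simp
      finally have "(\<Sum>r<M. z ^ r) = 0"
        using geometric_sum[OF \<open>z \<noteq> 1\<close>, of M] by simp
      moreover have "(\<zeta> ^ r) powi (j - k) = z ^ r" for r
        by (simp add: z_def power_int_power' power_int_power mult.commute)
      ultimately show ?thesis using False by simp
    qed simp
    have "(\<Sum>r<M. inverse ((\<zeta> ^ r) powi k) *\<^sub>C (\<Sum>j\<in>F. ((\<zeta> ^ r) powi j) *\<^sub>C C j))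
        = (\<Sum>r<M. \<Sum>j\<in>F. ((\<zeta> ^ r) powi (j - k)) *\<^sub>C C j)"
    proof -
      have "inverse ((\<zeta> ^ r) powi k) * (\<zeta> ^ r) powi j = (\<zeta> ^ r) powi (j - k)" for r j
        using \<zeta>1 by (simp add: power_int_diff divide_inverse)
      then show ?thesis by (simp add: complex_vector.scale_sum_right)
    qed
    also have "\<dots> = (\<Sum>j\<in>F. (\<Sum>r<M. (\<zeta> ^ r) powi (j - k)) *\<^sub>C C j)"
      by (subst sum.swap) (simp add: complex_vector.scale_sum_left)
    also have "\<dots> = (\<Sum>j\<in>F. if j = k then of_nat M *\<^sub>C C k else 0)"
      by (rule sum.cong) (auto simp: mean)
    also have "\<dots> = of_nat M *\<^sub>C C k" using fin k by simp
    finally have eq: "of_nat M *\<^sub>C C k =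
      (\<Sum>r<M. inverse ((\<zeta> ^ r) powi k) *\<^sub>C (\<Sum>j\<in>F. ((\<zeta> ^ r) powi j) *\<^sub>C C j))" by simp
    have "M * norm (C k) = norm (of_nat M *\<^sub>C C k)" by (simp add: norm_scaleC)
    also have "\<dots> \<le> (\<Sum>r<M. \<epsilon>)"
      unfolding eq
    proof (rule sum_norm_le)
      fix r
      have "cmod (\<zeta> ^ r) = 1" by (simp add: norm_power \<zeta>1)
      then show "norm (inverse ((\<zeta> ^ r) powi k) *\<^sub>C (\<Sum>j\<in>F. ((\<zeta> ^ r) powi j) *\<^sub>C C j)) \<le> \<epsilon>"
        using part[of "\<zeta> ^ r"] by (simp add: norm_scaleC norm_inverse norm_power_int)
    qed
    finally show ?thesis using \<open>M > 0\<close> by simp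
  qed
  then have "norm (C k) \<le> 0" by (rule field_le_epsilon) simp
  then show ?thesis by simp
qed

section \<open>Inner product modules\<close>

lemma norm_star: "norm (star a) = norm (a :: 'a::cstar_algebra)"
proof -
  have le: "norm a \<le> norm (star a)" for a :: 'a
  proof (cases "a = 0")
    case False
    have "norm a * norm a \<le> norm (star a) * norm a"
      using norm_mult_ineq[of "star a" a] by (simp add: norm_star_mult power2_eq_square)
    then show ?thesis using False by simp
  qed simp
  show ?thesis using le[of a] le[of "star a"] by (simp add: star_star)
qed

lemma bounded_linear_scaleC: "bounded_linear (\<lambda>x :: 'a::complex_normed_vector. c *\<^sub>C x)"
  by (rule bounded_linear_intro[where K = "cmod c"])
    (simp_all add: scaleC_add_right norm_scaleC scaleC_scaleC mult.commute flip: scaleC_of_real)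

context inner_product_module
begin

lemma ip_add_right: "ip x (y + z) = ip x y + ip x z"
  by (metis star_ip ip_add_left star_add)

lemma ip_scaleC_right: "ip x (c *\<^sub>C y) = cnj c *\<^sub>C ip x y"
  by (metis star_ip ip_scaleC_left star_scaleC)

lemma ip_act_right: "ip x (act a y) = ip x y * star a"
  by (metis star_ip ip_act_left star_mult)

lemma norm_power2_eq: "(norm x)\<^sup>2 = norm (ip x x)"
  by (simp add: norm_eq)

text \<open>
  The usual proof of the Cauchy-Schwarz inequality, with constant \<open>1\<close>, uses the order
  structure of the algebra. The constant \<open>4\<close> suffices here and follows from the
  triangle inequality of the module norm: polarization bounds the inner product by
  \<open>(norm x + norm y)\<^sup>2\<close>, and normalising both vectors gives the claim.
\<close>

lemma norm_ip_le: "norm (ip x y) \<le> 4 * norm x * norm y"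
proof -
  have zero: "ip 0 y = 0" "ip x 0 = 0" for x y
    using ip_scaleC_left[of 0 0 y] ip_scaleC_right[of x 0 0] by simp_all
  have sum: "norm (ip x y) \<le> (norm x + norm y)\<^sup>2" for x y
  proof -
    define s where "s c = ip (x + c *\<^sub>C y) (x + c *\<^sub>C y)" for c
    have s: "s c = ip x x + cnj c *\<^sub>C ip x y + (c *\<^sub>C ip y x + (c * cnj c) *\<^sub>C ip y y)" for c
      by (simp add: s_def ip_add_left ip_add_right ip_scaleC_left ip_scaleC_right scaleC_scaleC
          scaleC_add_right mult.commute)
    have "4 *\<^sub>C ip x y = 1 *\<^sub>C s 1 + (-1) *\<^sub>C s (-1) + (\<i> *\<^sub>C s \<i> + (- \<i>) *\<^sub>C s (- \<i>))"
    proof -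
      have four: "4 *\<^sub>C v = v + v + (v + v)" for v :: 'a
        using scaleC_add_left[of 1 1 v] scaleC_add_left[of 2 2 v] by simp
      show ?thesis
        unfolding s four
        by (simp add: scaleC_add_right complex_vector.scale_right_diff_distrib)
    qed
    also have "norm \<dots> \<le> norm (s 1) + norm (s (-1)) + (norm (s \<i>) + norm (s (- \<i>)))"
      by (intro order_trans[OF norm_triangle_ineq] add_mono) (simp_all add: norm_scaleC)
    also have "\<dots> \<le> (norm x + norm y)\<^sup>2 + (norm x + norm y)\<^sup>2 + ((norm x + norm y)\<^sup>2 + (norm x + norm y)\<^sup>2)"
    proof -
      have "norm (s c) \<le> (norm x + norm y)\<^sup>2" if "cmod c = 1" for c
      proof -
        have "norm (x + c *\<^sub>C y) \<le> norm x + norm y"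
          using norm_triangle_ineq[of x "c *\<^sub>C y"] that by (simp add: norm_scaleC)
        then show ?thesis
          unfolding s_def norm_power2_eq[symmetric] by (intro power_mono) auto
      qed
      then show ?thesis by (intro add_mono) auto
    qed
    finally show ?thesis by (simp add: norm_scaleC)
  qed
  show ?thesis
  proof (cases "x = 0 \<or> y = 0")
    case False
    define X Y where "X = complex_of_real (norm x)" and "Y = complex_of_real (norm y)"
    have XY: "X \<noteq> 0" "Y \<noteq> 0" "cmod X = norm x" "cmod Y = norm y" "cnj Y = Y"
      using False by (auto simp: X_def Y_def)
    have "norm (ip (inverse X *\<^sub>C x) (inverse Y *\<^sub>C y)) \<le> (1 + 1)\<^sup>2"
      using sum[of "inverse X *\<^sub>C x" "inverse Y *\<^sub>C y"] False XY
      by (simp add: norm_scaleC norm_inverse)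
    then have "norm (ip x y) / (norm x * norm y) \<le> 4"
      using XY by (simp add: ip_scaleC_left ip_scaleC_right norm_scaleC norm_inverse norm_mult divide_inverse mult_ac)
    then show ?thesis using False by (simp add: field_simps)
  qed (auto simp: zero)
qed

lemma bounded_bilinear_ip: "bounded_bilinear ip"
proof
  show "ip (r *\<^sub>R x) y = r *\<^sub>R ip x y" "ip x (r *\<^sub>R y) = r *\<^sub>R ip x y" for r x y
    by (simp_all add: scaleC_of_real[symmetric] ip_scaleC_left ip_scaleC_right)
  show "\<exists>K. \<forall>x y. norm (ip x y) \<le> norm x * norm y * K"
    using norm_ip_le by (intro exI[of _ 4]) (simp add: ac_simps)
qed (fact ip_add_left ip_add_right)+

sublocale ip: bounded_bilinear ip
  by (rule bounded_bilinear_ip)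

lemma norm_act_le: "norm (act a x) \<le> norm a * norm x"
proof -
  have "(norm (act a x))\<^sup>2 = norm (a * ip x x * star a)"
    by (simp add: norm_power2_eq ip_act_left ip_act_right mult.assoc)
  also have "\<dots> \<le> norm a * (norm x)\<^sup>2 * norm a"
    by (intro order_trans[OF norm_mult_ineq] mult_mono)
      (auto simp: norm_star norm_power2_eq)
  finally have "(norm (act a x))\<^sup>2 \<le> (norm a * norm x)\<^sup>2"
    by (simp add: power2_eq_square ac_simps)
  then show ?thesis by (rule power2_le_imp_le) simp
qed

end

section \<open>The sine of a unitary operator and its absolute value\<close>

text \<open>
  The powers \<open>u m\<close> of an invertible isometry \<open>u 1\<close>, indexed by the
  integers.
\<close>

locale unitary_action = hilbert_module act ip
  for act :: "'a::cstar_algebra \<Rightarrow> 'e::{complex_normed_vector,banach} \<Rightarrow> 'e"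
    and ip :: "'e \<Rightarrow> 'e \<Rightarrow> 'a" +
  fixes u :: "int \<Rightarrow> 'e \<Rightarrow> 'e"
  assumes u_zero: "u 0 x = x"
    and u_plus: "u (m + n) x = u m (u n x)"
    and u_add: "u m (x + y) = u m x + u m y"
    and u_scaleC: "u m (c *\<^sub>C x) = c *\<^sub>C u m x"
    and u_ip: "ip (u m x) (u m y) = ip x y"
begin

lemma norm_u: "norm (u m x) = norm x"
  by (simp add: norm_eq u_ip)

lemma bounded_linear_u: "bounded_linear (u m)"
  by (rule bounded_linear_intro[where K = 1])
    (simp_all add: u_add norm_u u_scaleC flip: scaleC_of_real)

lemma ip_u_left: "ip (u m x) y = ip x (u (- m) y)"
  using u_ip[of "- m" "u m x" y] by (simp add: u_zero flip: u_plus)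

text \<open>
  Multiplying the unitary by a scalar of modulus \<open>1\<close> translates its spectrum along the
  circle.
\<close>

lemma unitary_action_twist:
  assumes "cmod w = 1"
  shows "unitary_action act ip (\<lambda>m x. (w powi m) *\<^sub>C u m x)"
proof
  have "w \<noteq> 0" using assms by auto
  then show "(w powi (m + n)) *\<^sub>C u (m + n) x
      = (w powi m) *\<^sub>C u m ((w powi n) *\<^sub>C u n x)" for m n x
    by (simp add: power_int_add u_plus u_scaleC scaleC_scaleC)
  have "cnj z * z = 1" if "cmod z = 1" for z
    using that by (simp add: complex_norm_square[symmetric] mult.commute)
  then have "cnj (w powi m) * (w powi m) = 1" for m
    using assms by (intro \<open>\<And>z. cmod z = 1 \<Longrightarrow> cnj z * z = 1\<close>) (simp add: norm_power_int)
  then show "ip ((w powi m) *\<^sub>C u m x) ((w powi m) *\<^sub>C u m y) = ip x y" for m x y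
    by (simp add: ip_scaleC_left ip_scaleC_right u_ip scaleC_scaleC mult.commute)
qed (simp_all add: u_zero u_add u_scaleC scaleC_add_right scaleC_scaleC mult.commute)

text \<open>
  With \<open>u 1\<close> in the place of \<open>exp (i * t)\<close>, the first operator is
  \<open>sin t\<close> and the second is \<open>\<bar>sin t\<bar>\<close>, both multiplied by
  \<open>sqrt odd_square_sum\<close>. As the Fourier series of \<open>\<bar>sin t\<bar>\<close>
  converges absolutely, it can be evaluated at any invertible isometry without a functional
  calculus.
\<close>

definition sin_op :: "'e \<Rightarrow> 'e"
  where "sin_op x = complex_of_real (sqrt odd_square_sum / 2) *\<^sub>C (\<i> *\<^sub>C u (-1) x - \<i> *\<^sub>C u 1 x)"

definition abs_sin_op :: "'e \<Rightarrow> 'e"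
  where "abs_sin_op x = (\<Sum>\<^sub>\<infinity>j. abs_sin_coeff j *\<^sub>R u (2 * j) x)"

lemma abs_sin_op_has_sum: "((\<lambda>j. abs_sin_coeff j *\<^sub>R u (2 * j) x) has_sum abs_sin_op x) UNIV"
proof -
  have "(\<lambda>j. norm (abs_sin_coeff j *\<^sub>R u (2 * j) x)) summable_on UNIV"
    using summable_on_cmult_left[OF abs_sin_coeff_summable, of "norm x"] by (simp add: norm_u)
  then show ?thesis
    unfolding abs_sin_op_def by (rule has_sum_infsum[OF abs_summable_summable])
qed

lemma sin_op_self_adjoint: "ip (sin_op x) y = ip x (sin_op y)"
  by (simp add: sin_op_def ip_scaleC_left ip_scaleC_right ip.diff_left ip.diff_right ip_u_left
      complex_vector.scale_right_diff_distrib scaleC_scaleC)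

lemma abs_sin_op_self_adjoint: "ip (abs_sin_op x) y = ip x (abs_sin_op y)"
proof (rule has_sum_unique)
  show "((\<lambda>j. abs_sin_coeff j *\<^sub>R ip x (u (- (2 * j)) y)) has_sum ip (abs_sin_op x) y) UNIV"
    using has_sum_bounded_linear[OF ip.bounded_linear_left abs_sin_op_has_sum, of x y]
    by (simp add: ip.scaleR_left ip_u_left)
  have "((\<lambda>j. abs_sin_coeff j *\<^sub>R ip x (u (2 * j) y)) has_sum ip x (abs_sin_op y)) UNIV"
    using has_sum_bounded_linear[OF ip.bounded_linear_right abs_sin_op_has_sum, of x y]
    by (simp add: ip.scaleR_right)
  then show "((\<lambda>j. abs_sin_coeff j *\<^sub>R ip x (u (- (2 * j)) y)) has_sum ip x (abs_sin_op y)) UNIV"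
    using has_sum_int_reflect[of "\<lambda>j. abs_sin_coeff j *\<^sub>R ip x (u (2 * j) y)"]
    by (simp add: abs_sin_coeff_minus)
qed

lemma sin_op_square:
  "sin_op (sin_op x) = (odd_square_sum / 2) *\<^sub>R x - (odd_square_sum / 4) *\<^sub>R (u 2 x + u (- 2) x)"
proof -
  define d where "d = complex_of_real (sqrt odd_square_sum / 2)"
  have d: "d * d = complex_of_real (odd_square_sum / 4)"
    using odd_square_sum_pos by (simp add: d_def flip: of_real_mult)
  have diff: "u m (y - z) = u m y - u m z" for m y z
    using bounded_linear.linear[OF bounded_linear_u] by (rule linear_diff)
  have uu: "u 1 (u 1 x) = u 2 x" "u 1 (u (-1) x) = x" "u (-1) (u 1 x) = x" "u (-1) (u (-1) x) = u (-2) x"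
    using u_plus[of 1 1 x] u_plus[of 1 "-1" x] u_plus[of "-1" 1 x] u_plus[of "-1" "-1" x]
    by (simp_all add: u_zero)
  have "sin_op (sin_op x) = (d * d) *\<^sub>C (x + x - (u 2 x + u (- 2) x))"
    unfolding sin_op_def d_def[symmetric]
    by (simp add: diff u_scaleC uu complex_vector.scale_right_diff_distrib scaleC_scaleC
        scaleC_add_right algebra_simps)
  also have "\<dots> = (odd_square_sum / 4) *\<^sub>R (x + x - (u 2 x + u (- 2) x))"
    unfolding d by (rule scaleC_of_real)
  also have "\<dots> = (odd_square_sum / 2) *\<^sub>R x - (odd_square_sum / 4) *\<^sub>R (u 2 x + u (- 2) x)"
    by (simp add: scaleR_diff_right scaleR_add_right flip: scaleR_add_left)
  finally show ?thesis .
qed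

text \<open>
  Multiplying out the two series and summing along the antidiagonals reduces this to the convolution
  identity \<open>abs_sin_convolution\<close>.
\<close>

lemma abs_sin_op_square: "abs_sin_op (abs_sin_op x) = sin_op (sin_op x)"
proof -
  define f where "f j n = (abs_sin_coeff j * abs_sin_coeff (n - j)) *\<^sub>R u (2 * n) x" for j n
  have inner: "((\<lambda>n. f j n) has_sum abs_sin_coeff j *\<^sub>R u (2 * j) (abs_sin_op x)) UNIV" for j
  proof -
    have "((\<lambda>k. abs_sin_coeff j *\<^sub>R u (2 * j) (abs_sin_coeff k *\<^sub>R u (2 * k) x)) has_sum
        abs_sin_coeff j *\<^sub>R u (2 * j) (abs_sin_op x)) UNIV"
      by (rule has_sum_bounded_linear[OF bounded_linear_scaleR_right
            has_sum_bounded_linear[OF bounded_linear_u abs_sin_op_has_sum]])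
    then have "((\<lambda>k. f j (k + j)) has_sum abs_sin_coeff j *\<^sub>R u (2 * j) (abs_sin_op x)) UNIV"
      by (simp add: f_def linear_cmul[OF bounded_linear.linear, OF bounded_linear_u] algebra_simps flip: u_plus)
    then show ?thesis using has_sum_int_shift[of "f j" j] by simp
  qed
  have outer: "((\<lambda>j. f j n) has_sum sin_square_coeff n *\<^sub>R u (2 * n) x) UNIV" for n
    unfolding f_def
    by (rule has_sum_bounded_linear[OF bounded_linear_scaleR_left abs_sin_convolution])
  have "(\<lambda>(j, n). f j n) summable_on UNIV \<times> UNIV"
  proof (rule abs_summable_summable, rule Infinite_Sum.abs_summable_on_Sigma_iff[THEN iffD2], intro conjI ballI)
    have row: "((\<lambda>n. norm (f j n)) has_sum \<bar>abs_sin_coeff j\<bar> * ((\<Sum>\<^sub>\<infinity>k. \<bar>abs_sin_coeff k\<bar>) * norm x)) UNIV" for j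
    proof -
      have "((\<lambda>k. \<bar>abs_sin_coeff j\<bar> * (\<bar>abs_sin_coeff k\<bar> * norm x)) has_sum
          \<bar>abs_sin_coeff j\<bar> * ((\<Sum>\<^sub>\<infinity>k. \<bar>abs_sin_coeff k\<bar>) * norm x)) UNIV"
        by (intro has_sum_cmult_right has_sum_cmult_left has_sum_infsum abs_sin_coeff_summable)
      then have "((\<lambda>k. norm (f j (k + j))) has_sum
          \<bar>abs_sin_coeff j\<bar> * ((\<Sum>\<^sub>\<infinity>k. \<bar>abs_sin_coeff k\<bar>) * norm x)) UNIV"
        by (simp add: f_def norm_u abs_mult mult.assoc)
      then show ?thesis using has_sum_int_shift[of "\<lambda>n. norm (f j n)" j] by simp
    qed
    show "(\<lambda>n. norm (case (j, n) of (j, n) \<Rightarrow> f j n)) summable_on UNIV" for j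
      using row[of j] by (auto simp: summable_on_def)
    have "(\<lambda>j. \<bar>abs_sin_coeff j\<bar> * ((\<Sum>\<^sub>\<infinity>k. \<bar>abs_sin_coeff k\<bar>) * norm x)) summable_on UNIV"
      by (intro summable_on_cmult_left abs_sin_coeff_summable)
    moreover have "(\<Sum>\<^sub>\<infinity>n. norm (f j n)) = \<bar>abs_sin_coeff j\<bar> * ((\<Sum>\<^sub>\<infinity>k. \<bar>abs_sin_coeff k\<bar>) * norm x)" for j
      by (rule infsumI[OF row])
    moreover have "(\<Sum>\<^sub>\<infinity>k. \<bar>abs_sin_coeff k\<bar>) \<ge> 0" by (rule infsum_nonneg) simp
    ultimately show "(\<lambda>j. norm (\<Sum>\<^sub>\<infinity>n. norm (case (j, n) of (j, n) \<Rightarrow> f j n))) summable_on UNIV"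
      by (simp add: abs_mult)
  qed
  then have "(\<Sum>\<^sub>\<infinity>j. \<Sum>\<^sub>\<infinity>n. f j n) = (\<Sum>\<^sub>\<infinity>n. \<Sum>\<^sub>\<infinity>j. f j n)"
    by (rule infsum_swap_banach)
  moreover have "(\<Sum>\<^sub>\<infinity>j. \<Sum>\<^sub>\<infinity>n. f j n) = (\<Sum>\<^sub>\<infinity>j. abs_sin_coeff j *\<^sub>R u (2 * j) (abs_sin_op x))"
    by (rule infsum_cong) (rule infsumI[OF inner])
  moreover have "(\<Sum>\<^sub>\<infinity>n. \<Sum>\<^sub>\<infinity>j. f j n) = (\<Sum>\<^sub>\<infinity>n. sin_square_coeff n *\<^sub>R u (2 * n) x)"
    by (rule infsum_cong) (rule infsumI[OF outer])
  moreover have "((\<lambda>n. sin_square_coeff n *\<^sub>R u (2 * n) x) has_sum sin_op (sin_op x)) UNIV"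
    by (rule has_sum_finite_neutralI[of "{0, 1, -1}"])
      (auto simp: sin_square_coeff_def sin_op_square u_zero scaleR_add_right)
  ultimately show ?thesis by (simp add: abs_sin_op_def[of "abs_sin_op x"] infsumI)
qed

lemma sin_op_commute: "abs_sin_op (sin_op x) = sin_op (abs_sin_op x)"
proof (rule has_sum_unique)
  show "((\<lambda>j. abs_sin_coeff j *\<^sub>R u (2 * j) (sin_op x)) has_sum abs_sin_op (sin_op x)) UNIV"
    by (rule abs_sin_op_has_sum)
  have bl: "bounded_linear sin_op"
    unfolding sin_op_def
    by (intro bounded_linear_compose[OF bounded_linear_scaleC] bounded_linear_sub bounded_linear_u)
  have "sin_op (u m x) = u m (sin_op x)" for m
    by (simp add: sin_op_def u_scaleC linear_diff[OF bounded_linear.linear[OF bounded_linear_u]]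
        add.commute flip: u_plus)
  then show "((\<lambda>j. abs_sin_coeff j *\<^sub>R u (2 * j) (sin_op x)) has_sum sin_op (abs_sin_op x)) UNIV"
    using has_sum_bounded_linear[OF bl abs_sin_op_has_sum, of x]
    by (simp add: linear_cmul[OF bounded_linear.linear, OF bl])
qed

text \<open>
  Up to the common scale, the operators are twice the positive and twice the negative part of
  \<open>sin t\<close>; moving one to the other side gives
  \<open>\<bar>sin t\<bar>\<^sup>2 - (sin t)\<^sup>2 = 0\<close>. This is the supply of orthogonal
  pairs to which the hypothesis on the form is applied.
\<close>

lemma positive_negative_parts_orthogonal:
  "ip (abs_sin_op x + sin_op x) (abs_sin_op y - sin_op y) = 0"
  "ip (abs_sin_op x - sin_op x) (abs_sin_op y + sin_op y) = 0"
  by (simp_all add: ip.add_left ip.diff_left ip.add_right ip.diff_right)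
    (simp_all add: abs_sin_op_self_adjoint sin_op_self_adjoint abs_sin_op_square sin_op_commute)

end

section \<open>Sesquilinear forms that preserve orthogonality\<close>

locale orthogonality_preserving_form = hilbert_module act ip
  for act :: "'a::cstar_algebra \<Rightarrow> 'e::{complex_normed_vector,banach} \<Rightarrow> 'e"
    and ip :: "'e \<Rightarrow> 'e \<Rightarrow> 'a" +
  fixes B :: "'e \<Rightarrow> 'e \<Rightarrow> 'b::{complex_normed_vector,banach}"
  assumes bounded_bilinear_form: "bounded_bilinear B"
    and form_scaleC_left: "B (c *\<^sub>C x) y = c *\<^sub>C B x y"
    and form_scaleC_right: "B x (c *\<^sub>C y) = cnj c *\<^sub>C B x y"
    and form_orthogonal: "ip x y = 0 \<Longrightarrow> B x y = 0"
begin

sublocale form: bounded_bilinear B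
  by (rule bounded_bilinear_form)

text \<open>
  Subtracting the two orthogonality relations for the positive and the negative part cancels the
  terms in which the two arguments carry the same operator.
\<close>

lemma form_sin_abs_sin:
  assumes "unitary_action act ip u"
  shows "B (unitary_action.sin_op u x) (unitary_action.abs_sin_op u y) =
    B (unitary_action.abs_sin_op u x) (unitary_action.sin_op u y)"
proof -
  interpret unitary_action act ip u by fact
  let ?s = sin_op and ?n = abs_sin_op
  have "0 = B (?n x + ?s x) (?n y - ?s y) - B (?n x - ?s x) (?n y + ?s y)"
    using form_orthogonal[OF positive_negative_parts_orthogonal(1)[of x y]]
      form_orthogonal[OF positive_negative_parts_orthogonal(2)[of x y]] by simp
  also have "\<dots> = 2 *\<^sub>R (B (?s x) (?n y) - B (?n x) (?s y))"
    by (simp add: form.add_left form.diff_left form.add_right form.diff_right scaleR_2)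
  finally show ?thesis by simp
qed

text \<open>
  Apply \<open>form_sin_abs_sin\<close> to all twists of \<open>u\<close> by scalars
  \<open>w\<close> of modulus \<open>1\<close>. Both sides are Fourier series in \<open>w\<close>,
  so their coefficients agree. One coefficient involves only the values of
  \<open>abs_sin_coeff\<close> at \<open>0\<close>, \<open>1\<close> and \<open>-1\<close>, which
  are \<open>1\<close>, \<open>-1/3\<close> and \<open>-1/3\<close>, and it reads as a third
  difference. In terms of two points \<open>s\<close> and \<open>t\<close> of the spectrum: the
  integral of \<open>(sin (s - r))\<^sub>+ (sin (t - r))\<^sub>- exp (i * r)\<close> over a full
  period of \<open>r\<close>, antisymmetrised in \<open>s\<close> and \<open>t\<close>, is
  \<open>(exp (i * (s - t)) - 1)^3\<close> up to a factor of constant modulus.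
\<close>

lemma form_third_difference:
  assumes "unitary_action act ip u"
  shows "B (u 1 x) (u 2 y) - 3 *\<^sub>R B x (u 1 y) + 3 *\<^sub>R B (u (-1) x) y - B (u (-2) x) (u (-1) y) = 0"
proof -
  interpret unitary_action act ip u by fact
  let ?a = abs_sin_coeff
  \<comment> \<open>\<open>C k\<close> is the coefficient of \<open>v powi k\<close> with \<open>v = w\<^sup>2\<close> in the relation for the twist by
    \<open>w\<close>; the index shifts bring its four summands to the same power of \<open>v\<close>.\<close>
  define C where "C k = ?a k *\<^sub>R B (u (-1) x) (u (- (2 * k)) y)
      - ?a (k - 1) *\<^sub>R B (u 1 x) (u (- (2 * (k - 1))) y)
      + ?a (k - 1) *\<^sub>R B (u (2 * (k - 1)) x) (u (-1) y)
      - ?a k *\<^sub>R B (u (2 * k) x) (u 1 y)" for k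
  have "C 0 = 0"
  proof (rule fourier_coefficients_zero)
    obtain K where K: "\<And>a b. norm (B a b) \<le> norm a * norm b * K"
      using form.bounded by blast
    define M where "M = norm x * norm y * K"
    have M: "norm (B (u m x) (u n y)) \<le> M" for m n
      using K[of "u m x" "u n y"] by (simp add: norm_u M_def)
    have shift: "(\<lambda>k. \<bar>?a (k - 1)\<bar>) summable_on UNIV"
      using abs_sin_coeff_summable has_sum_int_shift[of "\<lambda>k. \<bar>?a k\<bar>" "-1"]
      by (simp add: summable_on_def)
    show "(\<lambda>k. norm (C k)) summable_on UNIV"
    proof (rule summable_on_comparison_test)
      show "(\<lambda>k. \<bar>?a k\<bar> * M + \<bar>?a (k - 1)\<bar> * M + \<bar>?a (k - 1)\<bar> * M + \<bar>?a k\<bar> * M) summable_on UNIV"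
        by (intro summable_on_add summable_on_cmult_left shift abs_sin_coeff_summable)
      show "norm (C k) \<le> \<bar>?a k\<bar> * M + \<bar>?a (k - 1)\<bar> * M + \<bar>?a (k - 1)\<bar> * M + \<bar>?a k\<bar> * M" for k
        unfolding C_def
        by (intro norm_triangle_le norm_triangle_le_diff add_mono)
          (simp_all add: mult_left_mono M)
    qed simp
    fix v :: complex assume v: "cmod v = 1"
    then have "v \<noteq> 0" by auto
    \<comment> \<open>After multiplication by \<open>w\<close> the relation for the twist by \<open>w\<close> contains only even powers
      of \<open>w\<close>, hence a square root of \<open>v\<close> turns it into a series in \<open>v\<close>.\<close>
    define w where "w = csqrt v"
    have w: "cmod w = 1" and ww: "w * w = v" "w \<noteq> 0"
      using v by (auto simp: w_def norm_csqrt simp flip: power2_eq_square)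
    have wcnj: "w * cnj w = 1" "cnj w * w = 1"
      using w by (simp_all add: complex_norm_square[symmetric] mult.commute)
    have even: "w powi (2 * j) = v powi j" for j
      using ww by (simp add: power_int_mult power2_eq_square)
    have vcnj: "cnj (v powi j) = v powi (- j)" for j
    proof -
      have "v powi j * cnj (v powi j) = 1"
        using complex_norm_square[of "v powi j"] v by (simp add: norm_power_int)
      then show ?thesis by (metis inverse_unique power_int_minus)
    qed
    interpret W: unitary_action act ip "\<lambda>m x. (w powi m) *\<^sub>C u m x"
      by (rule unitary_action_twist[OF w])
    have right: "((\<lambda>j. (v powi j) *\<^sub>C (?a j *\<^sub>R B p (u (- (2 * j)) y))) has_sum B p (W.abs_sin_op y)) UNIV" for p
    proof -
      have "((\<lambda>j. B p (?a j *\<^sub>R (w powi (2 * j)) *\<^sub>C u (2 * j) y)) has_sum B p (W.abs_sin_op y)) UNIV"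
        by (rule has_sum_bounded_linear[OF form.bounded_linear_right W.abs_sin_op_has_sum])
      moreover have "B p (?a j *\<^sub>R (w powi (2 * j)) *\<^sub>C u (2 * j) y) =
          (v powi (- j)) *\<^sub>C (?a j *\<^sub>R B p (u (2 * j) y))" for j
        unfolding even form.scaleR_right form_scaleC_right vcnj
        by (simp only: scaleC_of_real[symmetric] scaleC_scaleC mult.commute)
      ultimately have "((\<lambda>j. (v powi (- j)) *\<^sub>C (?a j *\<^sub>R B p (u (2 * j) y))) has_sum B p (W.abs_sin_op y)) UNIV"
        by (simp only:)
      then show ?thesis
        using has_sum_int_reflect[of "\<lambda>j. (v powi (- j)) *\<^sub>C (?a j *\<^sub>R B p (u (2 * j) y))"]
        by (simp add: abs_sin_coeff_minus)
    qed
    have left: "((\<lambda>j. (v powi j) *\<^sub>C (?a j *\<^sub>R B (u (2 * j) x) q)) has_sum B (W.abs_sin_op x) q) UNIV" for q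
    proof -
      have "((\<lambda>j. B (?a j *\<^sub>R (w powi (2 * j)) *\<^sub>C u (2 * j) x) q) has_sum B (W.abs_sin_op x) q) UNIV"
        by (rule has_sum_bounded_linear[OF form.bounded_linear_left W.abs_sin_op_has_sum])
      moreover have "B (?a j *\<^sub>R (w powi (2 * j)) *\<^sub>C u (2 * j) x) q =
          (v powi j) *\<^sub>C (?a j *\<^sub>R B (u (2 * j) x) q)" for j
        unfolding even form.scaleR_left form_scaleC_left
        by (simp only: scaleC_of_real[symmetric] scaleC_scaleC mult.commute)
      ultimately show ?thesis by (simp only:)
    qed
    have shift: "((\<lambda>j. (v powi j) *\<^sub>C f (j - 1)) has_sum v *\<^sub>C S) UNIV"
      if "((\<lambda>j. (v powi j) *\<^sub>C f j) has_sum S) UNIV" for f and S :: 'b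
    proof -
      have "((\<lambda>j. v *\<^sub>C ((v powi j) *\<^sub>C f j)) has_sum v *\<^sub>C S) UNIV"
        by (rule has_sum_bounded_linear[OF bounded_linear_scaleC that])
      then have "((\<lambda>j. (v powi (j + 1)) *\<^sub>C f j) has_sum v *\<^sub>C S) UNIV"
        using \<open>v \<noteq> 0\<close> by (simp add: scaleC_scaleC power_int_add mult.commute)
      then show ?thesis
        using has_sum_int_shift[of "\<lambda>j. (v powi (j + 1)) *\<^sub>C f j" "-1"] by simp
    qed
    have "((\<lambda>j. (v powi j) *\<^sub>C (?a j *\<^sub>R B (u (-1) x) (u (- (2 * j)) y))
        - (v powi j) *\<^sub>C (?a (j - 1) *\<^sub>R B (u 1 x) (u (- (2 * (j - 1))) y))
        + (v powi j) *\<^sub>C (?a (j - 1) *\<^sub>R B (u (2 * (j - 1)) x) (u (-1) y))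
        - (v powi j) *\<^sub>C (?a j *\<^sub>R B (u (2 * j) x) (u 1 y))) has_sum
        (B (u (-1) x) (W.abs_sin_op y) - v *\<^sub>C B (u 1 x) (W.abs_sin_op y)
          + v *\<^sub>C B (W.abs_sin_op x) (u (-1) y) - B (W.abs_sin_op x) (u 1 y))) UNIV"
      by (rule has_sum_diff[OF has_sum_add[OF has_sum_diff[OF right shift[OF right]] shift[OF left]] left])
    moreover have "B (u (-1) x) (W.abs_sin_op y) - v *\<^sub>C B (u 1 x) (W.abs_sin_op y)
          + v *\<^sub>C B (W.abs_sin_op x) (u (-1) y) - B (W.abs_sin_op x) (u 1 y) = 0"
      (is "?lhs = 0")
    proof -
      define d where "d = complex_of_real (sqrt odd_square_sum / 2)"
      have d: "d \<noteq> 0" "cnj d = d" using odd_square_sum_pos by (auto simp: d_def)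
      have "w powi (-1) = cnj w"
        using wcnj by (metis inverse_unique power_int_minus power_int_1_right)
      then have s: "W.sin_op z = d *\<^sub>C ((\<i> * cnj w) *\<^sub>C u (-1) z - (\<i> * w) *\<^sub>C u 1 z)" for z
        unfolding W.sin_op_def d_def by (simp add: scaleC_scaleC)
      have "0 = (\<i> * w) *\<^sub>C (B (W.abs_sin_op x) (W.sin_op y) - B (W.sin_op x) (W.abs_sin_op y))"
        using form_sin_abs_sin[OF W.unitary_action_axioms, of x y] by simp
      also have "\<dots> = d *\<^sub>C ?lhs"
        unfolding s
        by (simp add: form.diff_left form.diff_right form_scaleC_left form_scaleC_right d
            complex_vector.scale_right_diff_distrib scaleC_add_right scaleC_scaleC
            wcnj ww algebra_simps)
      finally show ?thesis using d by simp
    qed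
    ultimately show "((\<lambda>j. (v powi j) *\<^sub>C C j) has_sum 0) UNIV"
      by (simp add: C_def complex_vector.scale_right_diff_distrib scaleC_add_right)
  qed
  moreover have "C 0 = B (u (-1) x) y + (1 / 3) *\<^sub>R B (u 1 x) (u 2 y)
      - (1 / 3) *\<^sub>R B (u (-2) x) (u (-1) y) - B x (u 1 y)"
    by (simp add: C_def abs_sin_coeff_def u_zero)
  ultimately have "3 *\<^sub>R (B (u (-1) x) y + (1 / 3) *\<^sub>R B (u 1 x) (u 2 y)
      - (1 / 3) *\<^sub>R B (u (-2) x) (u (-1) y) - B x (u 1 y)) = 0" by simp
  then show ?thesis by (simp add: scaleR_add_right scaleR_diff_right algebra_simps)
qed

text \<open>
  By \<open>form_third_difference\<close> the sequence \<open>B (u n x) (u n y)\<close> has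
  vanishing third difference, and it is bounded because \<open>u\<close> is isometric.
\<close>

lemma form_unitary_invariant:
  assumes "unitary_action act ip u"
  shows "B (u 1 x) (u 1 y) = B x y"
proof -
  interpret unitary_action act ip u by fact
  obtain K where K: "\<And>a b. norm (B a b) \<le> norm a * norm b * K"
    using form.bounded by blast
  define D where "D n = B (u n x) (u n y)" for n
  have "D (n + 3) - 3 *\<^sub>R D (n + 2) + 3 *\<^sub>R D (n + 1) - D n = 0" for n
    using form_third_difference[OF assms, of "u (n + 2) x" "u (n + 1) y"]
    by (simp add: D_def add.commute add.left_commute flip: u_plus)
  moreover have "norm (D n) \<le> norm x * norm y * K" for n
    using K[of "u n x" "u n y"] by (simp add: D_def norm_u)
  ultimately have "D (0 + 1) = D 0" by (rule bounded_third_difference_zero)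
  then show ?thesis by (simp add: D_def u_zero)
qed

end

lemma (in hilbert_module) unitary_action_of_bij:
  assumes "bij U" "\<And>x y. U (x + y) = U x + U y" "\<And>c x. U (c *\<^sub>C x) = c *\<^sub>C U x"
    and "\<And>x y. ip (U x) (U y) = ip x y"
  obtains u where "unitary_action act ip u" "u 1 = U"
proof -
  define V where "V = inv U"
  have UV: "U (V x) = x" and VU: "V (U x) = x" for x
    using \<open>bij U\<close> by (simp_all add: V_def bij_is_surj bij_is_inj surj_f_inv_f)
  have V: "V (x + y) = V x + V y" "V (c *\<^sub>C x) = c *\<^sub>C V x" "ip (V x) (V y) = ip x y" for x y c
    by (metis assms(2) UV VU) (metis assms(3) UV VU, metis assms(4) UV)
  define u where "u m = (if m \<ge> 0 then U ^^ nat m else V ^^ nat (- m))" for m :: int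
  have u1: "u (m + 1) x = U (u m x)" for m x
  proof (cases "m \<ge> 0")
    case True
    then have "nat (m + 1) = Suc (nat m)" by simp
    then show ?thesis using True by (simp add: u_def)
  next
    case False
    then have "nat (- m) = Suc (nat (- (m + 1)))" by simp
    then have "u m x = V ((V ^^ nat (- (m + 1))) x)" using False by (simp add: u_def)
    moreover have "u (m + 1) x = (V ^^ nat (- (m + 1))) x"
      using False by (cases "m = -1") (auto simp: u_def)
    ultimately show ?thesis by (simp add: UV)
  qed
  have u2: "u (m - 1) x = V (u m x)" for m x
    using u1[of "m - 1" x] by (simp add: VU)
  have u0: "u 0 x = x" for x by (simp add: u_def)
  have "unitary_action act ip u"
  proof
    fix m n x y c
    show "u 0 x = x" by (rule u0)
    show "u (m + n) x = u m (u n x)"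
    proof (induction m rule: int_induct[where k = 0])
      case (step1 i)
      then show ?case using u1[of "i + n" x] u1[of i "u n x"] by (simp add: algebra_simps)
    next
      case (step2 i)
      then show ?case using u2[of "i + n" x] u2[of i "u n x"] by (simp add: algebra_simps)
    qed (simp add: u0)
    show "u m (x + y) = u m x + u m y"
      by (induction m rule: int_induct[where k = 0]) (simp_all add: u0 u1 u2 assms V)
    show "u m (c *\<^sub>C x) = c *\<^sub>C u m x"
      by (induction m rule: int_induct[where k = 0]) (simp_all add: u0 u1 u2 assms V)
    show "ip (u m x) (u m y) = ip x y"
      by (induction m rule: int_induct[where k = 0]) (simp_all add: u0 u1 u2 assms V)
  qed
  moreover have "u 1 = U" using u1[of 0] by (auto simp: u0)
  ultimately show ?thesis by (rule that)
qed

text \<open>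
  The equation \<open>x - f x = v\<close> asks for a fixed point of the contraction
  \<open>x \<mapsto> v + f x\<close>.
\<close>

lemma bij_id_minus_contraction:
  fixes f :: "'e::banach \<Rightarrow> 'e"
  assumes diff: "\<And>x y. f (x - y) = f x - f y"
    and norm: "\<And>x. norm (f x) \<le> q * norm x" and q: "0 \<le> q" "q < 1"
  shows "bij (\<lambda>x. x - f x)"
proof (rule bijI')
  fix v
  have "\<exists>!x. v + f x = x"
    by (rule banach_fix_type[OF q]) (simp add: dist_norm norm flip: diff)
  then obtain x where "v + f x = x" by blast
  then have "v = x - f x" by (simp add: eq_diff_eq)
  then show "\<exists>x. v = x - f x" by blast
next
  fix x y
  show "x - f x = y - f y \<longleftrightarrow> x = y"
  proof
    assume "x - f x = y - f y"
    then have "f (x - y) = x - y" by (simp add: diff algebra_simps)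
    then have "norm (x - y) \<le> q * norm (x - y)" using norm[of "x - y"] by simp
    then have "(1 - q) * norm (x - y) \<le> 0" by (simp add: algebra_simps)
    then show "x = y" using q by (simp add: mult_le_0_iff)
  qed simp
qed

context orthogonality_preserving_form
begin

text \<open>
  The Cayley transform \<open>U = (1 + J) (1 - J)\<^sup>-\<^sup>1\<close> of a small skew operator
  is unitary. Invariance of \<open>B\<close> under \<open>U\<close> says that
  \<open>B (x + J x) (y + J y) = B (x - J x) (y - J y)\<close>, and in the difference of the two
  sides only the terms linear in \<open>J\<close> survive.
\<close>

lemma form_skew:
  assumes add: "\<And>x y. J (x + y) = J x + J y" and scaleC: "\<And>c x. J (c *\<^sub>C x) = c *\<^sub>C J x"
    and skew: "\<And>x y. ip (J x) y = - ip x (J y)"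
    and norm: "\<And>x. norm (J x) \<le> q * norm x" and q: "0 \<le> q" "q < 1"
  shows "B (J x) y = - B x (J y)"
proof -
  define G H where "G x = x + J x" and "H x = x - J x" for x
  have minus: "J (- x) = - J x" for x using scaleC[of "-1" x] by simp
  have diff: "J (x - y) = J x - J y" for x y using add[of x "- y"] by (simp add: minus)
  have "bij H"
    unfolding H_def by (rule bij_id_minus_contraction[OF diff norm q])
  have "bij (\<lambda>x. x - - J x)"
    by (rule bij_id_minus_contraction[where q = q]) (simp_all add: diff norm q)
  then have "bij G" by (simp add: G_def[abs_def])
  define U where "U v = G (inv H v)" for v
  have U: "U (H x) = G x" for x
    using \<open>bij H\<close> by (simp add: U_def bij_is_inj)
  have H: "\<exists>x. v = H x" for v
    using \<open>bij H\<close> by (meson bij_pointE)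
  have "bij U"
    using bij_comp[OF bij_imp_bij_inv[OF \<open>bij H\<close>] \<open>bij G\<close>] by (simp add: U_def[abs_def] o_def)
  moreover have "U (v + w) = U v + U w" for v w
  proof -
    obtain x y where "v = H x" "w = H y" using H by metis
    moreover have "H x + H y = H (x + y)" "G x + G y = G (x + y)"
      by (simp_all add: G_def H_def add)
    ultimately show ?thesis by (simp add: U)
  qed
  moreover have "U (c *\<^sub>C v) = c *\<^sub>C U v" for c v
  proof -
    obtain x where "v = H x" using H by metis
    moreover have "c *\<^sub>C H x = H (c *\<^sub>C x)" "c *\<^sub>C G x = G (c *\<^sub>C x)"
      by (simp_all add: G_def H_def scaleC scaleC_add_right complex_vector.scale_right_diff_distrib)
    ultimately show ?thesis by (simp add: U)
  qed
  moreover have "ip (U v) (U w) = ip v w" for v w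
  proof -
    obtain x y where "v = H x" "w = H y" using H by metis
    then show ?thesis
      by (simp add: U) (simp add: G_def H_def ip.add_left ip.add_right ip.diff_left ip.diff_right skew)
  qed
  ultimately obtain u where u: "unitary_action act ip u" and "u 1 = U"
    by (rule unitary_action_of_bij) blast
  have "0 = B (G x) (G y) - B (H x) (H y)"
    using form_unitary_invariant[OF u, of "H x" "H y"] by (simp add: \<open>u 1 = U\<close> U)
  also have "\<dots> = 2 *\<^sub>R (B (J x) y + B x (J y))"
    by (simp add: G_def H_def form.add_left form.add_right form.diff_left form.diff_right scaleR_2)
  finally show ?thesis by (simp add: eq_neg_iff_add_eq_0)
qed

text \<open>
  For every small scalar \<open>c\<close> the operator \<open>c K - cnj c K'\<close> is skew, so
  \<open>form_skew\<close> applies to it. A real and an imaginary \<open>c\<close> together separate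
  \<open>K\<close> from its adjoint \<open>K'\<close>.
\<close>

lemma form_adjoint:
  assumes add: "\<And>x y. K (x + y) = K x + K y" "\<And>x y. K' (x + y) = K' x + K' y"
    and scaleC: "\<And>c x. K (c *\<^sub>C x) = c *\<^sub>C K x" "\<And>c x. K' (c *\<^sub>C x) = c *\<^sub>C K' x"
    and norm: "\<And>x. norm (K x) \<le> M * norm x" "\<And>x. norm (K' x) \<le> M * norm x"
    and adjoint: "\<And>x y. ip (K x) y = ip x (K' y)"
  shows "B (K x) y = B x (K' y)"
proof -
  have adjoint': "ip (K' x) y = ip x (K y)" for x y
    by (metis adjoint star_ip)
  \<comment> \<open>Small enough for \<open>c K - cnj c K'\<close> to have norm less than \<open>1\<close> when \<open>cmod c = \<epsilon>\<close>.\<close>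
  define \<epsilon> where "\<epsilon> = 1 / (4 * (\<bar>M\<bar> + 1))"
  have \<epsilon>: "\<epsilon> > 0" "2 * \<epsilon> * \<bar>M\<bar> < 1" by (simp_all add: \<epsilon>_def field_simps)
  have skew: "c *\<^sub>C B (K x) y - cnj c *\<^sub>C B (K' x) y = c *\<^sub>C B x (K' y) - cnj c *\<^sub>C B x (K y)"
    if c: "cmod c = \<epsilon>" for c
  proof -
    define J where "J z = c *\<^sub>C K z - cnj c *\<^sub>C K' z" for z
    have "B (J x) y = - B x (J y)"
    proof (rule form_skew[where q = "2 * \<epsilon> * \<bar>M\<bar>"])
      show "norm (J z) \<le> 2 * \<epsilon> * \<bar>M\<bar> * norm z" for z
      proof -
        have "M * norm z \<le> \<bar>M\<bar> * norm z" by (intro mult_right_mono) auto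
        then have "norm (K z) \<le> \<bar>M\<bar> * norm z" "norm (K' z) \<le> \<bar>M\<bar> * norm z"
          using norm(1)[of z] norm(2)[of z] by linarith+
        then have "\<epsilon> * norm (K z) + \<epsilon> * norm (K' z) \<le> \<epsilon> * (\<bar>M\<bar> * norm z) + \<epsilon> * (\<bar>M\<bar> * norm z)"
          using \<epsilon> by (intro add_mono mult_left_mono) auto
        then show ?thesis
          unfolding J_def using norm_triangle_ineq4[of "c *\<^sub>C K z" "cnj c *\<^sub>C K' z"]
          by (simp add: norm_scaleC c algebra_simps)
      qed
    qed (use \<epsilon> in \<open>simp_all add: J_def add scaleC scaleC_add_right scaleC_scaleC mult.commute
          complex_vector.scale_right_diff_distrib ip.diff_left ip.diff_right ip_scaleC_left ip_scaleC_right
          adjoint adjoint'\<close>)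
    then show ?thesis
      by (simp add: J_def form.diff_left form.diff_right form_scaleC_left form_scaleC_right)
  qed
  define p q p' q' where "p = B (K x) y" "q = B x (K' y)" "p' = B (K' x) y" "q' = B x (K y)"
  note defs = this
  have "complex_of_real \<epsilon> *\<^sub>C (p - p') = complex_of_real \<epsilon> *\<^sub>C (q - q')"
    using skew[of "complex_of_real \<epsilon>"] \<epsilon> by (simp add: defs complex_vector.scale_right_diff_distrib)
  then have 1: "p - p' = q - q'" using \<epsilon> by simp
  have "(\<i> * complex_of_real \<epsilon>) *\<^sub>C (p + p') = (\<i> * complex_of_real \<epsilon>) *\<^sub>C (q + q')"
    using skew[of "\<i> * complex_of_real \<epsilon>"] \<epsilon> by (simp add: defs norm_mult scaleC_add_right)
  then have 2: "p + p' = q + q'" using \<epsilon> by simp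
  have "2 *\<^sub>R p = (p - p') + (p + p')" by (simp add: scaleR_2)
  also have "\<dots> = 2 *\<^sub>R q" unfolding 1 2 by (simp add: scaleR_2)
  finally show ?thesis by (simp add: defs)
qed

end

section \<open>The action on a full Hilbert module bounds the norm\<close>

text \<open>
  Fullness as an induction principle: a closed linear condition on the algebra holds everywhere as
  soon as it holds for inner products.
\<close>

lemma (in full_hilbert_module) full_induct:
  assumes "closed {a. P a}" "P 0" "\<And>a b. P a \<Longrightarrow> P b \<Longrightarrow> P (a + b)"
    and "\<And>c a. P a \<Longrightarrow> P (c *\<^sub>C a)" "\<And>x y. P (ip x y)"
  shows "P a"
proof -
  have "complex_vector.subspace {a. P a}"
    using assms by (auto intro: complex_vector.subspaceI)
  then have "complex_vector.span {ip x y | x y. True} \<subseteq> {a. P a}"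
    using assms(5) by (intro complex_vector.span_minimal) auto
  then have "closure (complex_vector.span {ip x y | x y. True}) \<subseteq> {a. P a}"
    using assms(1) by (rule closure_minimal)
  then show ?thesis using full by auto
qed

lemma cstar_right_cancel:
  fixes a b :: "'a::cstar_algebra"
  assumes "\<And>c. a * c = b * c"
  shows "a = b"
proof -
  have "star (star (a - b)) * star (a - b) = 0"
    using assms[of "star (a - b)"] by (simp add: star_star left_diff_distrib)
  then have "star (a - b) = 0" using norm_star_mult[of "star (a - b)"] by simp
  then show ?thesis by (metis norm_star norm_eq_zero eq_iff_diff_eq_0)
qed

lemma cstar_left_cancel:
  fixes a b :: "'a::cstar_algebra"
  assumes "\<And>c. c * a = c * b"
  shows "a = b"
  using norm_star_mult[of "a - b"] assms[of "star (a - b)"]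
  by (simp add: right_diff_distrib)

text \<open>
  Repeated use of the identity \<open>norm (star b * b) = (norm b)\<^sup>2\<close> for the
  self-adjoint powers of \<open>d\<close>. As the algebra need not have a unit, the power of
  exponent \<open>2 ^ k\<close> is written as \<open>2 ^ k - 1\<close> left multiplications applied
  to \<open>d\<close>.
\<close>

lemma norm_self_adjoint_iterate:
  fixes d :: "'a::cstar_algebra"
  assumes "star d = d"
  shows "norm (((*) d ^^ (2 ^ k - 1)) d) = norm d ^ (2 ^ k)"
proof -
  define p where "p n = ((*) d ^^ n) d" for n
  have p_mult: "p m * p n = p (m + n + 1)" for m n
    by (induction m) (simp_all add: p_def mult.assoc)
  have p_star: "star (p n) = p n" for n
  proof (induction n)
    case (Suc n)
    have "star (p (Suc n)) = star (d * p n)" by (simp add: p_def)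
    also have "\<dots> = p n * p 0" using Suc assms by (simp add: star_mult) (simp add: p_def)
    also have "\<dots> = p (Suc n)" by (simp add: p_mult)
    finally show ?case .
  qed (simp add: p_def assms)
  have "norm (p (2 ^ k - 1)) = norm d ^ (2 ^ k)"
  proof (induction k)
    case (Suc k)
    have "2 ^ k \<ge> (1 :: nat)" by simp
    then have "(2 ^ k - 1) + (2 ^ k - 1) + 1 = (2 ^ Suc k - 1 :: nat)"
      by (simp only: power_Suc)
    then have "p (2 ^ Suc k - 1) = star (p (2 ^ k - 1)) * p (2 ^ k - 1)"
      by (simp only: p_star p_mult)
    then have "norm (p (2 ^ Suc k - 1)) = (norm d ^ (2 ^ k))\<^sup>2"
      using Suc by (simp add: norm_star_mult)
    then show ?case by (simp add: power_mult[symmetric] mult.commute)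
  qed (simp add: p_def)
  then show ?thesis by (simp add: p_def)
qed

context full_hilbert_module
begin

lemma iterate_growth:
  assumes bound: "\<And>x. norm (act d x) \<le> \<delta> * norm x" and "\<delta> \<ge> 0"
    and c: "c \<in> complex_vector.span {ip x y | x y. True}"
  shows "\<exists>C\<ge>0. \<forall>n. norm (((*) d ^^ n) c) \<le> C * \<delta> ^ n"
  using c
proof (induction rule: complex_vector.span_induct_alt)
  case base
  have "((*) d ^^ n) 0 = 0" for n by (induction n) auto
  then show ?case by (intro exI[of _ 0]) auto
next
  case (step s e b)
  then obtain x y where e: "e = ip x y" by blast
  obtain C where C: "C \<ge> 0" "\<And>n. norm (((*) d ^^ n) b) \<le> C * \<delta> ^ n"
    using step by blast
  \<comment> \<open>Left multiplication by \<open>d\<close> in the first factor of an inner product is the action of \<open>d\<close>.\<close>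
  have split: "((*) d ^^ n) (s *\<^sub>C e + b) = s *\<^sub>C ip ((act d ^^ n) x) y + ((*) d ^^ n) b" for n
    by (induction n) (simp_all add: e ip_act_left distrib_left mult_scaleC_right)
  have act_n: "norm ((act d ^^ n) x) \<le> \<delta> ^ n * norm x" for n
  proof (induction n)
    case (Suc n)
    then show ?case
      using bound[of "(act d ^^ n) x"] mult_left_mono[OF Suc \<open>\<delta> \<ge> 0\<close>] by (simp add: mult.assoc)
  qed simp
  show ?case
  proof (intro exI[of _ "cmod s * (4 * norm x * norm y) + C"] conjI allI)
    show "0 \<le> cmod s * (4 * norm x * norm y) + C" using C by simp
    fix n
    have "norm (ip ((act d ^^ n) x) y) \<le> 4 * (\<delta> ^ n * norm x) * norm y"
      by (rule order_trans[OF norm_ip_le]) (intro mult_right_mono mult_left_mono act_n; simp)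
    then have "cmod s * norm (ip ((act d ^^ n) x) y) \<le> cmod s * (4 * (\<delta> ^ n * norm x) * norm y)"
      by (intro mult_left_mono) auto
    then show "norm (((*) d ^^ n) (s *\<^sub>C e + b)) \<le> (cmod s * (4 * norm x * norm y) + C) * \<delta> ^ n"
      unfolding split
      using norm_triangle_ineq[of "s *\<^sub>C ip ((act d ^^ n) x) y" "((*) d ^^ n) b"] C(2)[of n]
      by (simp add: norm_scaleC algebra_simps)
  qed
qed

text \<open>
  A spectral radius argument. The powers of \<open>d\<close> grow at most like
  \<open>\<delta> ^ n\<close> on the span of the inner products, while a self-adjoint
  \<open>d\<close> satisfies \<open>norm (d ^ n) = norm d ^ n\<close> for \<open>n\<close> a power
  of two. By fullness the last factor of \<open>d ^ n\<close> can be replaced by a nearby element of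
  the span, so \<open>norm d\<close> cannot exceed \<open>\<delta>\<close>.
\<close>

lemma norm_le_of_self_adjoint_act:
  assumes bound: "\<And>x. norm (act d x) \<le> \<delta> * norm x" and "\<delta> \<ge> 0" and "star d = d"
  shows "norm d \<le> \<delta>"
proof (rule ccontr)
  assume less: "\<not> norm d \<le> \<delta>"
  define t where "t = norm d"
  have t: "t > \<delta>" "t > 0" using less \<open>\<delta> \<ge> 0\<close> by (auto simp: t_def)
  have "d \<in> closure (complex_vector.span {ip x y | x y. True})" using full by simp
  then have "\<exists>c\<in>complex_vector.span {ip x y | x y. True}. dist c d < t / 2"
    using t by (simp only: closure_approachable)
  then obtain c where c: "c \<in> complex_vector.span {ip x y | x y. True}" "dist c d < t / 2"
    by blast
  obtain C where C: "C \<ge> 0" "\<And>n. norm (((*) d ^^ n) c) \<le> C * \<delta> ^ n"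
    using iterate_growth[OF bound \<open>\<delta> \<ge> 0\<close> c(1)] by blast
  have large: "t / 2 \<le> C * (\<delta> / t) ^ (2 ^ k - 1)" for k
  proof -
    define N where "N = (2 ^ k - 1 :: nat)"
    have lin: "((*) d ^^ n) d = ((*) d ^^ n) c + ((*) d ^^ n) (d - c)" for n
      by (induction n) (simp_all add: distrib_left[symmetric])
    have pow: "norm (((*) d ^^ n) z) \<le> t ^ n * norm z" for n z
    proof (induction n)
      case (Suc n)
      then show ?case
        using order_trans[OF norm_mult_ineq[of d "((*) d ^^ n) z"] mult_left_mono[OF Suc norm_ge_zero[of d]]]
        by (simp add: t_def mult.assoc)
    qed simp
    have "t ^ N * t = t ^ (2 ^ k)"
      by (simp add: N_def flip: power_Suc2)
    also have "\<dots> = norm (((*) d ^^ N) d)"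
      using norm_self_adjoint_iterate[OF \<open>star d = d\<close>, of k] by (simp add: t_def N_def)
    also have "\<dots> \<le> norm (((*) d ^^ N) c) + norm (((*) d ^^ N) (d - c))"
      unfolding lin by (rule norm_triangle_ineq)
    also have "\<dots> \<le> C * \<delta> ^ N + t ^ N * (t / 2)"
      using c(2) t by (intro add_mono C order_trans[OF pow] mult_left_mono)
        (auto simp: dist_norm norm_minus_commute)
    finally have "t ^ N * (t / 2) \<le> C * \<delta> ^ N" by (simp add: field_simps)
    then show ?thesis unfolding N_def[symmetric] using t by (simp add: power_divide field_simps)
  qed
  have "\<delta> / t < 1" "0 \<le> \<delta> / t" using t \<open>\<delta> \<ge> 0\<close> by simp_all
  then obtain k where k: "(\<delta> / t) ^ k < (t / 2) / (C + 1)"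
    using real_arch_pow_inv[of "(t / 2) / (C + 1)" "\<delta> / t"] t C by auto
  have "k \<le> 2 ^ k - 1" using less_exp[of k] by linarith
  then have "(\<delta> / t) ^ (2 ^ k - 1) \<le> (\<delta> / t) ^ k"
    using \<open>\<delta> / t < 1\<close> \<open>0 \<le> \<delta> / t\<close> by (intro power_decreasing) auto
  then have "C * (\<delta> / t) ^ (2 ^ k - 1) \<le> (C + 1) * (\<delta> / t) ^ k"
    using C \<open>0 \<le> \<delta> / t\<close> by (intro mult_mono) auto
  also have "\<dots> < t / 2" using k C by (simp add: field_simps)
  finally show False using large[of k] by simp
qed

text \<open>
  The operators \<open>act b\<close> need not be adjointable, so the theorem that injective
  \<open>star\<close>-homomorphisms are isometric does not apply to the action. Instead, the
  self-adjoint element \<open>star b * b\<close> acts with norm at most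
  \<open>norm b * \<delta>\<close>, which gives
  \<open>(norm b)\<^sup>2 \<le> norm b * \<delta>\<close>.
\<close>

lemma norm_le_of_act:
  assumes bound: "\<And>x. norm (act b x) \<le> \<delta> * norm x" and "\<delta> \<ge> 0"
  shows "norm b \<le> \<delta>"
proof -
  have "norm (star b * b) \<le> norm b * \<delta>"
  proof (rule norm_le_of_self_adjoint_act)
    fix x
    have "norm (act (star b * b) x) \<le> norm b * norm (act b x)"
      using norm_act_le[of "star b" "act b x"] by (simp add: act_mult norm_star)
    also have "\<dots> \<le> norm b * (\<delta> * norm x)" by (intro mult_left_mono bound) simp
    finally show "norm (act (star b * b) x) \<le> norm b * \<delta> * norm x" by (simp add: mult.assoc)
  qed (simp_all add: \<open>\<delta> \<ge> 0\<close> star_mult star_star)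
  then show ?thesis
    using \<open>\<delta> \<ge> 0\<close> by (cases "b = 0") (simp_all add: norm_star_mult power2_eq_square)
qed

end

section \<open>The central multiplier of an orthogonality preserving form\<close>

lemma multiplier_to_multiplier:
  "m * to_multiplier a = to_multiplier (fst (Rep_multiplier m) a)"
  by transfer (auto simp: double_centralizer_def)

locale module_orthogonality_form = full_hilbert_module act ip + orthogonality_preserving_form act ip B
  for act :: "'a::cstar_algebra \<Rightarrow> 'e::{complex_normed_vector,banach} \<Rightarrow> 'e"
    and ip :: "'e \<Rightarrow> 'e \<Rightarrow> 'a"
    and B :: "'e \<Rightarrow> 'e \<Rightarrow> 'a" +
  assumes form_act_left: "B (act a x) y = a * B x y"
    and form_act_right: "B x (act a y) = B x y * star a"
begin

text \<open>
  Both sides are values of the form at a rank one operator and its adjoint,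
  \<open>v \<mapsto> act (ip v y) z\<close> and \<open>v \<mapsto> act (ip v z) y\<close>, to which
  \<open>form_adjoint\<close> applies.
\<close>

lemma form_ip_exchange: "ip x y * B z w = B x y * ip z w"
proof -
  have "B (act (ip x y) z) w = B x (act (ip w z) y)"
  proof (rule form_adjoint[of "\<lambda>v. act (ip v y) z" "\<lambda>v. act (ip v z) y" "4 * norm y * norm z"])
    show "norm (act (ip v y) z) \<le> 4 * norm y * norm z * norm v" for v
      by (rule order_trans[OF norm_act_le])
        (use mult_right_mono[OF norm_ip_le[of v y], of "norm z"] in \<open>simp add: ac_simps\<close>)
    show "norm (act (ip v z) y) \<le> 4 * norm y * norm z * norm v" for v
      by (rule order_trans[OF norm_act_le])
        (use mult_right_mono[OF norm_ip_le[of v z], of "norm y"] in \<open>simp add: ac_simps\<close>)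
  qed (simp_all add: ip_add_left act_add_left ip_scaleC_left act_scaleC_left
      ip_act_left ip_act_right star_ip)
  then show ?thesis by (simp add: form_act_left form_act_right star_ip)
qed

text \<open>
  The relation says that \<open>b\<close> is \<open>\<gamma> a\<close> for the multiplier
  \<open>\<gamma>\<close> that is to be constructed: both sides are then
  \<open>\<gamma> a (ip z w)\<close>.
\<close>

definition multiple_rel :: "'a \<Rightarrow> 'a \<Rightarrow> bool"
  where "multiple_rel a b \<longleftrightarrow> (\<forall>z w. b * ip z w = a * B z w)"

lemma multiple_rel_ip: "multiple_rel (ip x y) (B x y)"
  by (simp add: multiple_rel_def form_ip_exchange)

lemma multiple_rel_diff: "multiple_rel a b \<Longrightarrow> multiple_rel a' b' \<Longrightarrow> multiple_rel (a - a') (b - b')"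
  by (simp add: multiple_rel_def left_diff_distrib)

text \<open>
  If \<open>b\<close> is related to \<open>a\<close>, then
  \<open>ip (act b x) y = B (act a x) y\<close>. Taking \<open>y = act b x\<close> shows that
  \<open>b\<close> acts on the module with norm at most \<open>K * norm a\<close>, and
  \<open>norm_le_of_act\<close> turns this into a bound for \<open>b\<close> itself.
\<close>

lemma multiple_rel_bound:
  obtains K where "K \<ge> 0" "\<And>a b. multiple_rel a b \<Longrightarrow> norm b \<le> K * norm a"
proof -
  obtain K where K: "K \<ge> 0" "\<And>x y. norm (B x y) \<le> norm x * norm y * K"
    using form.nonneg_bounded by blast
  have "norm b \<le> K * norm a" if rel: "multiple_rel a b" for a b
  proof (rule norm_le_of_act)
    fix x
    have "ip (act b x) y = B (act a x) y" for y
      using rel by (simp add: multiple_rel_def ip_act_left form_act_left)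
    then have "(norm (act b x))\<^sup>2 = norm (B (act a x) (act b x))"
      by (simp add: norm_power2_eq)
    also have "\<dots> \<le> norm (act a x) * norm (act b x) * K" by (rule K)
    also have "\<dots> \<le> (norm a * norm x) * norm (act b x) * K"
      by (intro mult_right_mono norm_act_le K) auto
    finally have "norm (act b x) * norm (act b x) \<le> norm (act b x) * (K * norm a * norm x)"
      by (simp add: power2_eq_square ac_simps)
    then show "norm (act b x) \<le> K * norm a * norm x"
      using K by (cases "norm (act b x) = 0") (auto simp: mult_le_cancel_left)
  qed (use K in simp)
  then show ?thesis using K(1) that by blast
qed

text \<open>
  The elements \<open>a\<close> with a partner form a subspace that contains the inner products. It
  is closed, because by \<open>multiple_rel_bound\<close> partners of a convergent sequence are
  again Cauchy; so fullness gives existence. The same bound for \<open>a = 0\<close> gives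
  uniqueness.
\<close>

lemma multiple_rel_ex1: "\<exists>!b. multiple_rel a b"
proof -
  obtain K where K: "K \<ge> 0" "\<And>a b. multiple_rel a b \<Longrightarrow> norm b \<le> K * norm a"
    by (rule multiple_rel_bound) blast
  have "\<exists>b. multiple_rel a b"
  proof (induction a rule: full_induct)
    case 1
    show ?case
      unfolding closed_sequential_limits
    proof (intro allI impI, elim conjE)
      fix s a assume ex: "\<forall>n. s n \<in> {a. \<exists>b. multiple_rel a b}" and lim: "s \<longlonglongrightarrow> a"
      obtain t where t: "\<And>n. multiple_rel (s n) (t n)" using ex by simp metis
      have "Cauchy t"
      proof (rule CauchyI)
        fix e :: real assume "e > 0"
        then have "e / (K + 1) > 0" using K by simp
        then obtain M where M: "\<And>m n. m \<ge> M \<Longrightarrow> n \<ge> M \<Longrightarrow> norm (s m - s n) < e / (K + 1)"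
          using CauchyD[OF LIMSEQ_imp_Cauchy[OF lim]] by blast
        have "norm (t m - t n) < e" if "m \<ge> M" "n \<ge> M" for m n
        proof -
          have "norm (t m - t n) \<le> K * norm (s m - s n)" by (intro K multiple_rel_diff t)
          also have "\<dots> \<le> (K + 1) * norm (s m - s n)" by (intro mult_right_mono) auto
          also have "\<dots> < e" using M[OF that] K by (simp add: field_simps)
          finally show ?thesis .
        qed
        then show "\<exists>M. \<forall>m\<ge>M. \<forall>n\<ge>M. norm (t m - t n) < e" by blast
      qed
      then obtain b where b: "t \<longlonglongrightarrow> b" using Cauchy_convergent convergent_def by blast
      have "b * ip z w = a * B z w" for z w
      proof (rule LIMSEQ_unique)
        show "(\<lambda>n. t n * ip z w) \<longlonglongrightarrow> b * ip z w" by (intro tendsto_intros b)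
        show "(\<lambda>n. t n * ip z w) \<longlonglongrightarrow> a * B z w"
          using t by (simp add: multiple_rel_def) (intro tendsto_intros lim)
      qed
      then show "a \<in> {a. \<exists>b. multiple_rel a b}" by (auto simp: multiple_rel_def)
    qed
  next
    case 2
    show ?case by (intro exI[of _ 0]) (simp add: multiple_rel_def)
  next
    case (3 a b)
    then obtain a' b' where "multiple_rel a a'" "multiple_rel b b'" by blast
    then show ?case by (intro exI[of _ "a' + b'"]) (simp add: multiple_rel_def distrib_right)
  next
    case (4 c a)
    then obtain a' where "multiple_rel a a'" by blast
    then show ?case by (intro exI[of _ "c *\<^sub>C a'"]) (simp add: multiple_rel_def mult_scaleC_left)
  next
    case (5 x y)
    show ?case using multiple_rel_ip by blast
  qed
  moreover have "b = b'" if "multiple_rel a b" "multiple_rel a b'" for b b'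
    using K(2)[OF multiple_rel_diff[OF that]] by simp
  ultimately show ?thesis by blast
qed

definition multiple :: "'a \<Rightarrow> 'a"
  where "multiple a = (THE b. multiple_rel a b)"

lemma multiple_eq_iff: "multiple a = b \<longleftrightarrow> multiple_rel a b"
  unfolding multiple_def using multiple_rel_ex1 by (metis theI')

lemma multiple_mult_ip: "multiple a * ip z w = a * B z w"
  using multiple_eq_iff[of a "multiple a"] by (simp add: multiple_rel_def)

lemma multiple_ip: "multiple (ip x y) = B x y"
  by (simp add: multiple_eq_iff multiple_rel_ip)

lemma multiple_mult_left: "multiple (a * b) = a * multiple b"
  by (simp add: multiple_eq_iff multiple_rel_def mult.assoc multiple_mult_ip)

lemma multiple_mult_right: "multiple (a * b) = multiple a * b"
proof -
  have "multiple a * b * ip z w = a * b * B z w" for z w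
    using multiple_mult_ip[of a "act b z" w] by (simp add: ip_act_left form_act_left mult.assoc)
  then show ?thesis by (simp add: multiple_eq_iff multiple_rel_def)
qed

lemma bounded_clinear_multiple: "bounded_clinear multiple"
proof -
  obtain K where K: "K \<ge> 0" "\<And>a b. multiple_rel a b \<Longrightarrow> norm b \<le> K * norm a"
    by (rule multiple_rel_bound) blast
  have scaleC: "multiple (c *\<^sub>C a) = c *\<^sub>C multiple a" for c a
    by (simp add: multiple_eq_iff multiple_rel_def mult_scaleC_left multiple_mult_ip)
  have "bounded_linear multiple"
  proof (rule bounded_linear_intro)
    show "multiple (a + b) = multiple a + multiple b" for a b
      by (simp add: multiple_eq_iff multiple_rel_def distrib_right multiple_mult_ip)
    show "multiple (r *\<^sub>R a) = r *\<^sub>R multiple a" for r a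
      by (simp add: scaleC flip: scaleC_of_real)
    show "norm (multiple a) \<le> norm a * K" for a
      using K(2)[of a "multiple a"] by (simp add: multiple_mult_ip multiple_rel_def mult.commute)
  qed
  then show ?thesis by (simp add: bounded_clinear_def scaleC)
qed

lemma double_centralizer_multiple: "double_centralizer (multiple, multiple)"
  by (simp add: double_centralizer_def bounded_clinear_multiple
      flip: multiple_mult_left multiple_mult_right)

definition form_multiplier :: "'a multiplier"
  where "form_multiplier = Abs_multiplier (multiple, multiple)"

lemma Rep_form_multiplier: "Rep_multiplier form_multiplier = (multiple, multiple)"
  by (simp add: form_multiplier_def Abs_multiplier_inverse double_centralizer_multiple)

text \<open>
  The map \<open>multiple\<close> commutes with left and right multiplications in the algebra; as
  elements of the algebra are determined by their products, it also commutes with the two components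
  of any multiplier.
\<close>

lemma form_multiplier_central: "form_multiplier \<in> center"
proof -
  have "form_multiplier * w = w * form_multiplier" for w
  proof -
    obtain L R where w: "Rep_multiplier w = (L, R)" by fastforce
    have "double_centralizer (L, R)" using Rep_multiplier[of w] by (simp add: w)
    then have LR: "\<And>a b. L (a * b) = L a * b" "\<And>a b. R (a * b) = a * R b"
      by (simp_all add: double_centralizer_def)
    have "multiple (L a) = L (multiple a)" for a
    proof (rule cstar_right_cancel)
      fix c
      have "multiple (L a) * c = L a * multiple c"
        by (simp flip: multiple_mult_left multiple_mult_right)
      also have "\<dots> = L (multiple a * c)"
        by (simp add: LR flip: multiple_mult_right) (simp add: multiple_mult_left LR)
      finally show "multiple (L a) * c = L (multiple a) * c" by (simp add: LR)
    qed
    moreover have "R (multiple a) = multiple (R a)" for a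
    proof (rule cstar_left_cancel)
      fix c
      have "c * multiple (R a) = multiple c * R a"
        by (simp flip: multiple_mult_left multiple_mult_right)
      also have "\<dots> = R (c * multiple a)"
        by (simp add: LR flip: multiple_mult_left) (simp add: multiple_mult_right LR)
      finally show "c * R (multiple a) = c * multiple (R a)" by (simp add: LR)
    qed
    ultimately have "Rep_multiplier (form_multiplier * w) = Rep_multiplier (w * form_multiplier)"
      by (simp add: times_multiplier.rep_eq Rep_form_multiplier w)
    then show ?thesis by (simp add: Rep_multiplier_inject)
  qed
  then show ?thesis by (simp add: center_def)
qed

lemma form_multiplier_mult_ip: "form_multiplier * to_multiplier (ip x y) = to_multiplier (B x y)"
  by (simp add: multiplier_to_multiplier Rep_form_multiplier multiple_ip)

end

theorem theorem4p1:
  fixes actE :: "'a::cstar_algebra \<Rightarrow> 'e::{complex_normed_vector,banach} \<Rightarrow> 'e"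
    and ipE :: "'e \<Rightarrow> 'e \<Rightarrow> 'a"
    and actF :: "'a \<Rightarrow> 'f::{complex_normed_vector,banach} \<Rightarrow> 'f"
    and ipF :: "'f \<Rightarrow> 'f \<Rightarrow> 'a"
    and T S :: "'e \<Rightarrow> 'f"
  assumes "full_hilbert_module actE ipE"
    and "full_hilbert_module actF ipF"
    and "bounded_module_map actE actF T"
    and "bounded_module_map actE actF S"
    and "T \<noteq> (\<lambda>x. 0)"
    and "S \<noteq> (\<lambda>x. 0)"
    and "\<And>x y. ipE x y = 0 \<Longrightarrow> ipF (T x) (S y) = 0"
  shows "\<exists>\<gamma> \<in> (center :: 'a multiplier set).
    (\<forall>x y. to_multiplier (ipF (T x) (S y)) = \<gamma> * to_multiplier (ipE x y)) \<and>
    (\<gamma> = 0 \<longrightarrow> (\<forall>x y. ipF (T x) (S y) = 0))"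
proof -
  interpret E: full_hilbert_module actE ipE by fact
  interpret F: full_hilbert_module actF ipF by fact
  interpret TS: bounded_bilinear "\<lambda>x y. ipF (T x) (S y)"
    using assms(3,4) by (intro F.ip.comp) (simp_all add: bounded_module_map_def bounded_clinear_def)
  interpret module_orthogonality_form actE ipE "\<lambda>x y. ipF (T x) (S y)"
    by unfold_locales (use assms in \<open>simp_all add: bounded_module_map_def bounded_clinear_def
      F.ip_scaleC_left F.ip_scaleC_right F.ip_act_left F.ip_act_right\<close>)
  have zero: "ipF (T x) (S y) = 0" if "form_multiplier = 0" for x y
  proof -
    have "to_multiplier (ipF (T x) (S y)) = to_multiplier 0"
      using that form_multiplier_mult_ip[of x y] to_multiplier_add[of 0 "0 :: 'a"] by simp
    then show ?thesis by (rule injD[OF inj_to_multiplier])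
  qed
  show ?thesis
    by (rule bexI[OF _ form_multiplier_central]) (use form_multiplier_mult_ip zero in simp)
qed

end
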